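(* Let $R$ be an almost Cohen--Macaulay commutative noetherian ring of dimension $d\geq 2$. Then: (i) $\operatorname{Ass}(\overline{R}/R)^{\geq 2}\subseteq\operatorname{Spec}(R)^{2}\setminus\mathrm{CM}(R)$. (ii) If in addition $R$ is reduced, then $\operatorname{Ass}(\overline{R}/R)^{\geq 2}=\operatorname{Spec}(R)^{2}\setminus\mathrm{CM}(R)$. In particular, in this case $\operatorname{Ass}(\overline{R}/R)^{\geq 2}$ is finite provided $\mathrm{CM}(R)$ is open in $\operatorname{Spec}(R)$.
   Context: The normalization $\overline{R}$ is the integral closure of $R$ in its total quotient ring $Q(R)$ (the localization of $R$ at all non-zerodivisors). For $X\subseteq\operatorname{Spec}(R)$, $X^{\geq i}:=\{\mathfrak{p}\in X:\operatorname{ht}(\mathfrak{p})\geq i\}$ and $X^{i}:=\{\mathfrak{p}\in X:\operatorname{ht}(\mathfrak{p})=i\}$. $\operatorname{Ass}(M)$ is the set of associated primes of the $R$-module $M$. $\mathrm{CM}(R):=\{\mathfrak{p}\in\operatorname{Spec}(R):R_{\mathfrak{p}}\text{ is Cohen--Macaulay}\}$. $R$ is almost Cohen--Macaulay if $\operatorname{grade}(\mathfrak{p},R)=\operatorname{grade}(\mathfrak{p}R_{\mathfrak{p}},R_{\mathfrak{p}})$ for every $\mathfrak{p}\in\operatorname{Spec}(R)$. *)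

theory Defs
  imports "HOL-Algebra.Algebra" "HOL-Analysis.Abstract_Topology" "HOL-Library.Extended_Nat"
begin

section \<open>Prime spectrum, height, Krull dimension\<close>

definition Spec :: "('a, 'm) ring_scheme \<Rightarrow> 'a set set" where
  "Spec R = {p. primeideal p R}"

text \<open>A list \<open>c\<close> of length \<open>n\<close> such that \<open>c @ [p]\<close> is strictly increasing is a chain
  \<open>p\<^sub>0 \<subset> \<dots> \<subset> p\<^sub>n = p\<close> of primes.\<close>

definition height :: "('a, 'm) ring_scheme \<Rightarrow> 'a set \<Rightarrow> enat" where
  "height R p = Sup {enat (length c) | c. set c \<subseteq> Spec R \<and> sorted_wrt (\<subset>) (c @ [p])}"

text \<open>The zero ring gets dimension \<open>0\<close> here.\<close>

definition krull_dim :: "('a, 'm) ring_scheme \<Rightarrow> enat" where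
  "krull_dim R = (SUP p\<in>Spec R. height R p)"

definition ht_ge :: "('a, 'm) ring_scheme \<Rightarrow> 'a set set \<Rightarrow> nat \<Rightarrow> 'a set set" where
  "ht_ge R P i = {p \<in> P. height R p \<ge> enat i}"

definition ht_eq :: "('a, 'm) ring_scheme \<Rightarrow> 'a set set \<Rightarrow> nat \<Rightarrow> 'a set set" where
  "ht_eq R P i = {p \<in> P. height R p = enat i}"

definition zariski :: "('a, 'm) ring_scheme \<Rightarrow> 'a set topology" where
  "zariski R = topology (\<lambda>U. \<exists>E \<subseteq> carrier R. U = {p \<in> Spec R. \<not> E \<subseteq> p})"

lemma istopology_zariski:
  assumes "cring R"
  shows "istopology (\<lambda>U. \<exists>E \<subseteq> carrier R. U = {p \<in> Spec R. \<not> E \<subseteq> p})" (is "istopology ?O")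
  unfolding istopology_def
proof (intro conjI allI impI)
  fix U V assume "?O U" "?O V"
  then obtain E F where E: "E \<subseteq> carrier R" "U = {p \<in> Spec R. \<not> E \<subseteq> p}"
    and F: "F \<subseteq> carrier R" "V = {p \<in> Spec R. \<not> F \<subseteq> p}" by blast
  let ?G = "{e \<otimes>\<^bsub>R\<^esub> f | e f. e \<in> E \<and> f \<in> F}"
  interpret cring R by fact
  have G: "?G \<subseteq> carrier R" using E(1) F(1) by blast
  have eq: "\<not> ?G \<subseteq> p \<longleftrightarrow> \<not> E \<subseteq> p \<and> \<not> F \<subseteq> p" if "p \<in> Spec R" for p
  proof -
    interpret p: primeideal p R using that by (simp add: Spec_def)
    have "?G \<subseteq> p" if "E \<subseteq> p \<or> F \<subseteq> p"
      using that E(1) F(1) p.I_l_closed p.I_r_closed by blast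
    moreover have False if *: "?G \<subseteq> p" "\<not> E \<subseteq> p" "\<not> F \<subseteq> p"
    proof -
      obtain e f where ef: "e \<in> E" "e \<notin> p" "f \<in> F" "f \<notin> p" using * by blast
      then have "e \<otimes>\<^bsub>R\<^esub> f \<in> p" using *(1) by blast
      then show False using p.I_prime ef E(1) F(1) by blast
    qed
    ultimately show ?thesis by blast
  qed
  have "U \<inter> V = {p \<in> Spec R. \<not> ?G \<subseteq> p}" using eq E(2) F(2) by blast
  then show "?O (U \<inter> V)" using G by blast
next
  fix \<K> assume "\<forall>K\<in>\<K>. ?O K"
  then obtain E where E: "\<And>K. K \<in> \<K> \<Longrightarrow> E K \<subseteq> carrier R \<and> K = {p \<in> Spec R. \<not> E K \<subseteq> p}"
    by metis
  have "\<Union>\<K> = {p \<in> Spec R. \<not> (\<Union>K\<in>\<K>. E K) \<subseteq> p}" using E by blast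
  moreover have "(\<Union>K\<in>\<K>. E K) \<subseteq> carrier R" using E by blast
  ultimately show "?O (\<Union>\<K>)" by blast
qed

lemma openin_zariski:
  assumes "cring R"
  shows "openin (zariski R) U \<longleftrightarrow> (\<exists>E \<subseteq> carrier R. U = {p \<in> Spec R. \<not> E \<subseteq> p})"
  using istopology_zariski[OF assms] by (simp add: zariski_def topology_inverse')

section \<open>Localization\<close>

definition loc_rel ::
    "('a, 'm) ring_scheme \<Rightarrow> 'a set \<Rightarrow> (('a \<times> 'a) \<times> ('a \<times> 'a)) set" where
  "loc_rel R S = {((a, s), (b, t)). a \<in> carrier R \<and> b \<in> carrier R \<and> s \<in> S \<and> t \<in> S \<and>
     (\<exists>u\<in>S. u \<otimes>\<^bsub>R\<^esub> (t \<otimes>\<^bsub>R\<^esub> a \<ominus>\<^bsub>R\<^esub> s \<otimes>\<^bsub>R\<^esub> b) = \<zero>\<^bsub>R\<^esub>)}"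

definition fraction :: "('a, 'm) ring_scheme \<Rightarrow> 'a set \<Rightarrow> 'a \<Rightarrow> 'a \<Rightarrow> ('a \<times> 'a) set" where
  "fraction R S a s = loc_rel R S `` {(a, s)}"

definition localization :: "('a, 'm) ring_scheme \<Rightarrow> 'a set \<Rightarrow> ('a \<times> 'a) set ring" where
  "localization R S =
    \<lparr>carrier = (carrier R \<times> S) // loc_rel R S,
     monoid.mult = (\<lambda>U V. \<Union>(a, s)\<in>U. \<Union>(b, t)\<in>V. fraction R S (a \<otimes>\<^bsub>R\<^esub> b) (s \<otimes>\<^bsub>R\<^esub> t)),
     one = fraction R S \<one>\<^bsub>R\<^esub> \<one>\<^bsub>R\<^esub>,
     ring.zero = fraction R S \<zero>\<^bsub>R\<^esub> \<one>\<^bsub>R\<^esub>,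
     add = (\<lambda>U V. \<Union>(a, s)\<in>U. \<Union>(b, t)\<in>V.
              fraction R S (t \<otimes>\<^bsub>R\<^esub> a \<oplus>\<^bsub>R\<^esub> s \<otimes>\<^bsub>R\<^esub> b) (s \<otimes>\<^bsub>R\<^esub> t))\<rparr>"

context cring
begin

context
  fixes S assumes S: "submonoid S R"
begin

lemma denom_carrier: "s \<in> S \<Longrightarrow> s \<in> carrier R" using S submonoid.mem_carrier by fastforce
lemma denom_mult: "s \<in> S \<Longrightarrow> t \<in> S \<Longrightarrow> s \<otimes> t \<in> S" using S submonoid.m_closed by fastforce
lemma denom_one: "\<one> \<in> S" using S submonoid.one_closed by fastforce

lemma loc_relI: "a \<in> carrier R \<Longrightarrow> b \<in> carrier R \<Longrightarrow> s \<in> S \<Longrightarrow> t \<in> S \<Longrightarrow> u \<in> S \<Longrightarrow> 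
   u \<otimes> (t \<otimes> a \<ominus> s \<otimes> b) = \<zero> \<Longrightarrow> ((a,s),(b,t)) \<in> loc_rel R S"
  unfolding loc_rel_def by blast

lemma loc_rel_trans_identity: assumes "a \<in> carrier R" "b \<in> carrier R" "c \<in> carrier R" "s \<in> carrier R" "t \<in> carrier R" "r \<in> carrier R" "u \<in> carrier R" "v \<in> carrier R"
  shows "(u \<otimes> v \<otimes> t) \<otimes> (r \<otimes> a \<ominus> s \<otimes> c) = r \<otimes> v \<otimes> (u \<otimes> (t \<otimes> a \<ominus> s \<otimes> b)) \<oplus> s \<otimes> u \<otimes> (v \<otimes> (r \<otimes> b \<ominus> t \<otimes> c))"
  using assms by algebra

lemma equiv_loc_rel: "equiv (carrier R \<times> S) (loc_rel R S)"
proof (intro equivI refl_onI symI transI)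
  show "loc_rel R S \<subseteq> (carrier R \<times> S) \<times> (carrier R \<times> S)" by (auto simp: loc_rel_def)
  fix x assume "x \<in> carrier R \<times> S"
  then show "(x, x) \<in> loc_rel R S" 
    by (cases x) (auto intro!: loc_relI[of _ _ _ _ \<one>] denom_one simp: denom_carrier)
next
  fix x y assume "(x, y) \<in> loc_rel R S"
  then obtain a s b t u where *: "x = (a,s)" "y = (b,t)" "a \<in> carrier R" "b \<in> carrier R" "s \<in> S" "t \<in> S" "u \<in> S" "u \<otimes> (t \<otimes> a \<ominus> s \<otimes> b) = \<zero>"
    by (auto simp: loc_rel_def)
  have "u \<otimes> (s \<otimes> b \<ominus> t \<otimes> a) = \<ominus> (u \<otimes> (t \<otimes> a \<ominus> s \<otimes> b))" using *(3-7) denom_carrier by algebra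
  then show "(y, x) \<in> loc_rel R S" using * by (auto intro: loc_relI)
next
  fix x y z assume "(x, y) \<in> loc_rel R S" "(y, z) \<in> loc_rel R S"
  then obtain a s b t u c r v where *: "x = (a,s)" "y = (b,t)" "z = (c,r)" "a \<in> carrier R" "b \<in> carrier R" "c \<in> carrier R" "s \<in> S" "t \<in> S" "r \<in> S" "u \<in> S" "v \<in> S"
     and e: "u \<otimes> (t \<otimes> a \<ominus> s \<otimes> b) = \<zero>" "v \<otimes> (r \<otimes> b \<ominus> t \<otimes> c) = \<zero>"
    by (auto simp: loc_rel_def)
  have "(u \<otimes> v \<otimes> t) \<otimes> (r \<otimes> a \<ominus> s \<otimes> c) = \<zero>"
    using loc_rel_trans_identity[of a b c s t r u v] * denom_carrier by (simp add: e)
  then show "(x, z) \<in> loc_rel R S" using * denom_mult by (auto intro!: loc_relI[where u="u \<otimes> v \<otimes> t"])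
qed

lemma fraction_eq: "((a,s),(b,t)) \<in> loc_rel R S \<Longrightarrow> fraction R S a s = fraction R S b t"
  unfolding fraction_def using equiv_class_eq[OF equiv_loc_rel] by blast

lemma fraction_memD: "x \<in> fraction R S a s \<Longrightarrow> \<exists>b t. x = (b,t) \<and> ((a,s),(b,t)) \<in> loc_rel R S"
  unfolding fraction_def by (cases x) auto
lemma fraction_self: "a \<in> carrier R \<Longrightarrow> s \<in> S \<Longrightarrow> (a,s) \<in> fraction R S a s"
  unfolding fraction_def using equiv_class_self[OF equiv_loc_rel] by auto

lemma UN_fraction_const: assumes ab: "a \<in> carrier R" "b \<in> carrier R" "s \<in> S" "t \<in> S"
  and F: "\<And>a' s' b' t'. ((a,s),(a',s')) \<in> loc_rel R S \<Longrightarrow> ((b,t),(b',t')) \<in> loc_rel R S \<Longrightarrow> F a' s' b' t' = Z"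
  shows "(\<Union>(a, s)\<in>fraction R S a s. \<Union>(b, t)\<in>fraction R S b t. F a s b t) = Z"
proof -
  have "(case x of (a',s') \<Rightarrow> \<Union>(b', t')\<in>fraction R S b t. F a' s' b' t') = Z" if xm: "x \<in> fraction R S a s" for x
  proof -
    obtain a' s' where x: "x = (a',s')" "((a,s),(a',s')) \<in> loc_rel R S" using fraction_memD[OF xm] by blast
    have "(case y of (b',t') \<Rightarrow> F a' s' b' t') = Z" if "y \<in> fraction R S b t" for y
      using fraction_memD[OF that] F[OF x(2)] by auto
    then show ?thesis unfolding x(1) prod.case using fraction_self[OF ab(2,4)] by (intro SUP_eq_const) auto
  qed
  then show ?thesis using fraction_self[OF ab(1,3)] by (intro SUP_eq_const) auto
qed

lemma fraction_mult: assumes "a \<in> carrier R" "b \<in> carrier R" "s \<in> S" "t \<in> S"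
  shows "fraction R S a s \<otimes>\<^bsub>localization R S\<^esub> fraction R S b t = fraction R S (a \<otimes> b) (s \<otimes> t)"
  unfolding localization_def monoid.simps
proof (rule UN_fraction_const[OF assms])
  fix a' s' b' t' assume "((a,s),(a',s')) \<in> loc_rel R S" "((b,t),(b',t')) \<in> loc_rel R S"
  then obtain u v where *: "a' \<in> carrier R" "b' \<in> carrier R" "s' \<in> S" "t' \<in> S" "u \<in> S" "v \<in> S"
    and e: "u \<otimes> (s' \<otimes> a \<ominus> s \<otimes> a') = \<zero>" "v \<otimes> (t' \<otimes> b \<ominus> t \<otimes> b') = \<zero>" by (auto simp: loc_rel_def)
  have cc: "s \<in> carrier R" "t \<in> carrier R" "s' \<in> carrier R" "t' \<in> carrier R" "u \<in> carrier R" "v \<in> carrier R" using * assms denom_carrier by auto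
  have "(u \<otimes> v) \<otimes> ((s \<otimes> t) \<otimes> (a' \<otimes> b') \<ominus> (s' \<otimes> t') \<otimes> (a \<otimes> b)) =
    \<ominus> (v \<otimes> t' \<otimes> b \<otimes> (u \<otimes> (s' \<otimes> a \<ominus> s \<otimes> a'))) \<ominus> u \<otimes> s \<otimes> a' \<otimes> (v \<otimes> (t' \<otimes> b \<ominus> t \<otimes> b'))"
    using cc assms(1,2) *(1,2) by algebra
  then have "(u \<otimes> v) \<otimes> ((s \<otimes> t) \<otimes> (a' \<otimes> b') \<ominus> (s' \<otimes> t') \<otimes> (a \<otimes> b)) = \<zero>"
    using cc assms(1,2) *(1,2) unfolding e by simp
  then show "fraction R S (a' \<otimes> b') (s' \<otimes> t') = fraction R S (a \<otimes> b) (s \<otimes> t)"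
    using * assms denom_mult by (intro fraction_eq loc_relI[where u="u \<otimes> v"]) auto
qed

lemma fraction_add: assumes "a \<in> carrier R" "b \<in> carrier R" "s \<in> S" "t \<in> S"
  shows "fraction R S a s \<oplus>\<^bsub>localization R S\<^esub> fraction R S b t = fraction R S (t \<otimes> a \<oplus> s \<otimes> b) (s \<otimes> t)"
  unfolding localization_def ring.simps
proof (rule UN_fraction_const[OF assms])
  fix a' s' b' t' assume "((a,s),(a',s')) \<in> loc_rel R S" "((b,t),(b',t')) \<in> loc_rel R S"
  then obtain u v where *: "a' \<in> carrier R" "b' \<in> carrier R" "s' \<in> S" "t' \<in> S" "u \<in> S" "v \<in> S"
    and e: "u \<otimes> (s' \<otimes> a \<ominus> s \<otimes> a') = \<zero>" "v \<otimes> (t' \<otimes> b \<ominus> t \<otimes> b') = \<zero>" by (auto simp: loc_rel_def)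
  have cc: "s \<in> carrier R" "t \<in> carrier R" "s' \<in> carrier R" "t' \<in> carrier R" "u \<in> carrier R" "v \<in> carrier R" using * assms denom_carrier by auto
  have "(u \<otimes> v) \<otimes> ((s \<otimes> t) \<otimes> (t' \<otimes> a' \<oplus> s' \<otimes> b') \<ominus> (s' \<otimes> t') \<otimes> (t \<otimes> a \<oplus> s \<otimes> b)) =
    \<ominus> (v \<otimes> t' \<otimes> t \<otimes> (u \<otimes> (s' \<otimes> a \<ominus> s \<otimes> a'))) \<ominus> u \<otimes> s \<otimes> s' \<otimes> (v \<otimes> (t' \<otimes> b \<ominus> t \<otimes> b'))"
    using cc assms(1,2) *(1,2) by algebra
  then have "(u \<otimes> v) \<otimes> ((s \<otimes> t) \<otimes> (t' \<otimes> a' \<oplus> s' \<otimes> b') \<ominus> (s' \<otimes> t') \<otimes> (t \<otimes> a \<oplus> s \<otimes> b)) = \<zero>"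
    using cc assms(1,2) *(1,2) unfolding e by simp
  then show "fraction R S (t' \<otimes> a' \<oplus> s' \<otimes> b') (s' \<otimes> t') = fraction R S (t \<otimes> a \<oplus> s \<otimes> b) (s \<otimes> t)"
    using * cc assms denom_mult by (intro fraction_eq loc_relI[where u="u \<otimes> v"]) auto
qed

lemma loc_carrier: "U \<in> carrier (localization R S) \<longleftrightarrow> (\<exists>a s. a \<in> carrier R \<and> s \<in> S \<and> U = fraction R S a s)"
  unfolding localization_def partial_object.simps quotient_def fraction_def by auto

lemma fraction_in_carrier: "a \<in> carrier R \<Longrightarrow> s \<in> S \<Longrightarrow> fraction R S a s \<in> carrier (localization R S)"
  unfolding loc_carrier by blast

lemma fraction_eqI: "a \<in> carrier R \<Longrightarrow> b \<in> carrier R \<Longrightarrow> s \<in> S \<Longrightarrow> t \<in> S \<Longrightarrow> t \<otimes> a = s \<otimes> b \<Longrightarrow> fraction R S a s = fraction R S b t"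
  by (rule fraction_eq, rule loc_relI[where u=\<one>]) (auto simp: denom_one denom_carrier)

lemma loc_one: "\<one>\<^bsub>localization R S\<^esub> = fraction R S \<one> \<one>"
  and loc_zero: "\<zero>\<^bsub>localization R S\<^esub> = fraction R S \<zero> \<one>"
  by (simp_all add: localization_def)

lemma cring_localization: "cring (localization R S)"
proof (rule cringI)
  let ?L = "localization R S"
  show "abelian_group ?L"
  proof (rule abelian_groupI)
    fix x y z assume "x \<in> carrier ?L" "y \<in> carrier ?L" "z \<in> carrier ?L"
    then obtain a s b t c u where x: "a \<in> carrier R" "s \<in> S" "x = fraction R S a s" "b \<in> carrier R" "t \<in> S" "y = fraction R S b t"
       "c \<in> carrier R" "u \<in> S" "z = fraction R S c u" unfolding loc_carrier by blast
    have cc: "s \<in> carrier R" "t \<in> carrier R" "u \<in> carrier R" using x denom_carrier by auto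
    have "u \<otimes> (t \<otimes> a \<oplus> s \<otimes> b) \<oplus> s \<otimes> t \<otimes> c = t \<otimes> u \<otimes> a \<oplus> s \<otimes> (u \<otimes> b \<oplus> t \<otimes> c)" using x(1,4,7) cc by algebra
    then show "x \<oplus>\<^bsub>?L\<^esub> y \<oplus>\<^bsub>?L\<^esub> z = x \<oplus>\<^bsub>?L\<^esub> (y \<oplus>\<^bsub>?L\<^esub> z)"
      using x cc by (simp add: fraction_add denom_mult m_assoc) 
  next
    fix x y assume "x \<in> carrier ?L" "y \<in> carrier ?L"
    then obtain a s b t where x: "a \<in> carrier R" "s \<in> S" "x = fraction R S a s" "b \<in> carrier R" "t \<in> S" "y = fraction R S b t"
      unfolding loc_carrier by blast
    have cc: "s \<in> carrier R" "t \<in> carrier R" using x denom_carrier by auto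
    show "x \<oplus>\<^bsub>?L\<^esub> y \<in> carrier ?L" unfolding x(3,6) fraction_add[OF x(1,4,2,5)] using x cc by (intro fraction_in_carrier) (auto intro: denom_mult)
    show "x \<oplus>\<^bsub>?L\<^esub> y = y \<oplus>\<^bsub>?L\<^esub> x" using x cc by (simp add: fraction_add m_comm a_comm)
  next
    show "\<zero>\<^bsub>?L\<^esub> \<in> carrier ?L" unfolding loc_zero by (intro fraction_in_carrier) (auto simp: denom_one)
  next
    fix x assume "x \<in> carrier ?L"
    then obtain a s where x: "a \<in> carrier R" "s \<in> S" "x = fraction R S a s" unfolding loc_carrier by blast
    show "\<zero>\<^bsub>?L\<^esub> \<oplus>\<^bsub>?L\<^esub> x = x" using x denom_carrier denom_one by (simp add: loc_zero fraction_add)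
    have "fraction R S (\<ominus> a) s \<oplus>\<^bsub>?L\<^esub> x = \<zero>\<^bsub>?L\<^esub>" using x denom_carrier[of s] denom_one
      by (simp add: loc_zero fraction_add r_minus l_neg denom_mult, intro fraction_eqI) (simp_all add: denom_mult)
    then show "\<exists>y\<in>carrier ?L. y \<oplus>\<^bsub>?L\<^esub> x = \<zero>\<^bsub>?L\<^esub>" using fraction_in_carrier[of "\<ominus> a" s] x by blast
  qed
  show "comm_monoid ?L"
  proof (rule comm_monoidI)
    fix x y z assume "x \<in> carrier ?L" "y \<in> carrier ?L" "z \<in> carrier ?L"
    then obtain a s b t c u where x: "a \<in> carrier R" "s \<in> S" "x = fraction R S a s" "b \<in> carrier R" "t \<in> S" "y = fraction R S b t"
       "c \<in> carrier R" "u \<in> S" "z = fraction R S c u" unfolding loc_carrier by blast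
    have cc: "s \<in> carrier R" "t \<in> carrier R" "u \<in> carrier R" using x denom_carrier by auto
    show "x \<otimes>\<^bsub>?L\<^esub> y \<otimes>\<^bsub>?L\<^esub> z = x \<otimes>\<^bsub>?L\<^esub> (y \<otimes>\<^bsub>?L\<^esub> z)"
      using x cc by (simp add: fraction_mult denom_mult m_assoc) 
  next
    fix x y assume "x \<in> carrier ?L" "y \<in> carrier ?L"
    then obtain a s b t where x: "a \<in> carrier R" "s \<in> S" "x = fraction R S a s" "b \<in> carrier R" "t \<in> S" "y = fraction R S b t"
      unfolding loc_carrier by blast
    have cc: "s \<in> carrier R" "t \<in> carrier R" using x denom_carrier by auto
    show "x \<otimes>\<^bsub>?L\<^esub> y \<in> carrier ?L" unfolding x(3,6) fraction_mult[OF x(1,4,2,5)] using x cc by (intro fraction_in_carrier) (auto intro: denom_mult)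
    show "x \<otimes>\<^bsub>?L\<^esub> y = y \<otimes>\<^bsub>?L\<^esub> x" using x cc by (simp add: fraction_mult m_comm)
  next
    show "\<one>\<^bsub>?L\<^esub> \<in> carrier ?L" unfolding loc_one by (intro fraction_in_carrier) (auto simp: denom_one)
  next
    fix x assume "x \<in> carrier ?L"
    then obtain a s where x: "a \<in> carrier R" "s \<in> S" "x = fraction R S a s" unfolding loc_carrier by blast
    show "\<one>\<^bsub>?L\<^esub> \<otimes>\<^bsub>?L\<^esub> x = x" using x denom_carrier denom_one by (simp add: loc_one fraction_mult)
  qed
  fix x y z assume "x \<in> carrier ?L" "y \<in> carrier ?L" "z \<in> carrier ?L"
  then obtain a s b t c u where x: "a \<in> carrier R" "s \<in> S" "x = fraction R S a s" "b \<in> carrier R" "t \<in> S" "y = fraction R S b t"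
     "c \<in> carrier R" "u \<in> S" "z = fraction R S c u" unfolding loc_carrier by blast
  have cc: "s \<in> carrier R" "t \<in> carrier R" "u \<in> carrier R" using x denom_carrier by auto
  have "s \<otimes> u \<otimes> (t \<otimes> u) \<otimes> ((t \<otimes> a \<oplus> s \<otimes> b) \<otimes> c) =
      s \<otimes> t \<otimes> u \<otimes> (t \<otimes> u \<otimes> (a \<otimes> c) \<oplus> s \<otimes> u \<otimes> (b \<otimes> c))" using x(1,4,7) cc by algebra
  then show "(x \<oplus>\<^bsub>?L\<^esub> y) \<otimes>\<^bsub>?L\<^esub> z = x \<otimes>\<^bsub>?L\<^esub> z \<oplus>\<^bsub>?L\<^esub> y \<otimes>\<^bsub>?L\<^esub> z"
    using x cc by (simp add: fraction_mult fraction_add denom_mult, intro fraction_eqI) (simp_all add: denom_mult)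
qed

end
end

definition loc_map :: "('a, 'm) ring_scheme \<Rightarrow> 'a set \<Rightarrow> 'a \<Rightarrow> ('a \<times> 'a) set" where
  "loc_map R S a = fraction R S a \<one>\<^bsub>R\<^esub>"

definition loc_at :: "('a, 'm) ring_scheme \<Rightarrow> 'a set \<Rightarrow> ('a \<times> 'a) set ring" where
  "loc_at R p = localization R (carrier R - p)"

text \<open>The extension \<open>pR\<^sub>p\<close>.\<close>

definition loc_ideal :: "('a, 'm) ring_scheme \<Rightarrow> 'a set \<Rightarrow> ('a \<times> 'a) set set" where
  "loc_ideal R p = Idl\<^bsub>loc_at R p\<^esub> (loc_map R (carrier R - p) ` p)"

section \<open>Total quotient ring and normalization\<close>

definition nonzerodivisors :: "('a, 'm) ring_scheme \<Rightarrow> 'a set" where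
  "nonzerodivisors R = {a \<in> carrier R. \<forall>b\<in>carrier R. a \<otimes>\<^bsub>R\<^esub> b = \<zero>\<^bsub>R\<^esub> \<longrightarrow> b = \<zero>\<^bsub>R\<^esub>}"

definition total_quot :: "('a, 'm) ring_scheme \<Rightarrow> ('a \<times> 'a) set ring" where
  "total_quot R = localization R (nonzerodivisors R)"

text \<open>Polynomials are coefficient lists, leading coefficient first, so \<open>\<one> # cs\<close> is an
  arbitrary monic polynomial of degree \<open>length cs\<close>.\<close>

definition integral_closure :: "('a, 'm) ring_scheme \<Rightarrow> 'a set \<Rightarrow> 'a set" where
  "integral_closure A K =
     {x \<in> carrier A. \<exists>cs. set cs \<subseteq> K \<and> ring.eval A (\<one>\<^bsub>A\<^esub> # cs) x = \<zero>\<^bsub>A\<^esub>}"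

text \<open>The image of \<open>R\<close> in its total quotient ring.\<close>

definition base_image :: "('a, 'm) ring_scheme \<Rightarrow> ('a \<times> 'a) set set" where
  "base_image R = loc_map R (nonzerodivisors R) ` carrier R"

definition normalization :: "('a, 'm) ring_scheme \<Rightarrow> ('a \<times> 'a) set ring" where
  "normalization R = (total_quot R)\<lparr>carrier := integral_closure (total_quot R) (base_image R)\<rparr>"

section \<open>Modules and associated primes\<close>

text \<open>\<open>mult\<close> and \<open>one\<close> are only present because the module record extends the ring record;
  they play no role in a module.\<close>

definition quot_module :: "('a, 'b, 'n) module_scheme \<Rightarrow> 'b set \<Rightarrow> ('a, 'b set) module" where
  "quot_module M N =
    \<lparr>carrier = a_rcosets\<^bsub>M\<^esub> N, monoid.mult = undefined, one = undefined, ring.zero = N,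
     add = (<+>\<^bsub>M\<^esub>), smult = (\<lambda>r C. \<Union>x\<in>C. N +>\<^bsub>M\<^esub> (r \<odot>\<^bsub>M\<^esub> x))\<rparr>"

definition normalization_module :: "('a, 'm) ring_scheme \<Rightarrow> ('a, ('a \<times> 'a) set) module" where
  "normalization_module R = ring.extend (normalization R)
     (module.fields (\<lambda>r x. loc_map R (nonzerodivisors R) r \<otimes>\<^bsub>total_quot R\<^esub> x))"

definition normalization_mod_base ::
    "('a, 'm) ring_scheme \<Rightarrow> ('a, ('a \<times> 'a) set set) module" where
  "normalization_mod_base R = quot_module (normalization_module R) (base_image R)"

definition Ass :: "('a, 'm) ring_scheme \<Rightarrow> ('a, 'b, 'n) module_scheme \<Rightarrow> 'a set set" where
  "Ass R M = {p \<in> Spec R. \<exists>x\<in>carrier M. p = {r \<in> carrier R. r \<odot>\<^bsub>M\<^esub> x = \<zero>\<^bsub>M\<^esub>}}"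

section \<open>Grade and Cohen--Macaulay properties\<close>

definition regular_sequence :: "('a, 'm) ring_scheme \<Rightarrow> 'a list \<Rightarrow> bool" where
  "regular_sequence R xs \<longleftrightarrow> set xs \<subseteq> carrier R \<and> Idl\<^bsub>R\<^esub> (set xs) \<noteq> carrier R \<and>
     (\<forall>i < length xs. let J = Idl\<^bsub>R\<^esub> (set (take i xs)) in
        J +>\<^bsub>R\<^esub> (xs ! i) \<in> nonzerodivisors (R Quot J))"

text \<open>For a proper ideal of a noetherian ring this is the common length of all maximal
  regular sequences in \<open>I\<close>.\<close>

definition grade :: "('a, 'm) ring_scheme \<Rightarrow> 'a set \<Rightarrow> enat" where
  "grade R I = Sup {enat (length xs) | xs. set xs \<subseteq> I \<and> regular_sequence R xs}"

text \<open>A noetherian local ring is Cohen--Macaulay if its depth, the grade of its maximal ideal,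
  equals its dimension.\<close>

definition cohen_macaulay_local :: "('a, 'm) ring_scheme \<Rightarrow> bool" where
  "cohen_macaulay_local A \<longleftrightarrow> cring A \<and> noetherian_ring A \<and>
     (\<exists>m. {m'. maximalideal m' A} = {m} \<and> grade A m = krull_dim A)"

definition CM :: "('a, 'm) ring_scheme \<Rightarrow> 'a set set" where
  "CM R = {p \<in> Spec R. cohen_macaulay_local (loc_at R p)}"

definition almost_cohen_macaulay :: "('a, 'm) ring_scheme \<Rightarrow> bool" where
  "almost_cohen_macaulay R \<longleftrightarrow>
     (\<forall>p\<in>Spec R. grade R p = grade (loc_at R p) (loc_ideal R p))"

definition reduced_ring :: "('a, 'm) ring_scheme \<Rightarrow> bool" where
  "reduced_ring R \<longleftrightarrow>
     (\<forall>x\<in>carrier R. \<forall>n::nat. x [^]\<^bsub>R\<^esub> n = \<zero>\<^bsub>R\<^esub> \<longrightarrow> x = \<zero>\<^bsub>R\<^esub>)"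

end

theory Submission
  imports Defs
begin

text \<open>Write \<open>p = (sR : a)\<close> for the annihilator of \<open>a/s + R\<close> in \<open>Q(R)/R\<close>, where \<open>s\<close> is a nonzerodivisor.
Membership of \<open>p\<close> in the associated primes of the normalization modulo \<open>R\<close> says that \<open>p\<close> is prime and
has this form for some integral \<open>a/s\<close> (\<open>Ass_normalization_mod_base_iff\<close>); in particular
\<open>p\<close> is associated to \<open>R/sR\<close>.

For (i), an associated prime of \<open>R/sR\<close> has grade exactly 1: along a regular sequence \<open>x, y\<close> in \<open>p\<close> one
could trade \<open>s\<close> for \<open>x\<close> and see that \<open>y\<close> kills a nonzero element modulo \<open>x\<close>
(\<open>grade_assoc_prime_principal\<close>). In an almost Cohen--Macaulay ring grade 1 forces height at most 2
(\<open>height_le_2_if_grade_1\<close>): every prime \<open>q\<close> with \<open>s \<in> q \<subseteq> p\<close> has grade at most 1, hence local depth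
at most 1, hence is associated to \<open>R/sR\<close>. There are finitely many such primes, so some \<open>y \<in> p\<close> avoids all
those properly below \<open>p\<close>; then \<open>p\<close> is minimal over \<open>(s, y)\<close>, and Krull's height theorem bounds its height
by 2. A prime of height 2 and grade 1 is not Cohen--Macaulay.

For (ii), let \<open>R\<close> be reduced and \<open>p\<close> of height 2 outside the Cohen--Macaulay locus. Reducedness gives grade
at least 1, grade is at most height, and so the grade is 1; hence \<open>p = (sR : a)\<close> with \<open>s \<in> p\<close>. If the
fraction \<open>x = a/s\<close> did not map \<open>p\<close> into itself, then \<open>p\<close> would be minimal over a single element, against
the principal ideal theorem. So \<open>x p \<subseteq> p\<close>, all \<open>s x\<^sup>n\<close> lie in \<open>R\<close>, and the ascending chain of the
ideals \<open>(s, s x, \<dots>, s x\<^sup>n)\<close> yields an integral equation for \<open>x\<close>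
(\<open>integral_if_stabilizes_ideal\<close>). For finiteness, reduced almost Cohen--Macaulay rings are Cohen--Macaulay
at all primes of height at most 1, so the primes of height 2 outside an open Cohen--Macaulay locus are
minimal over the ideal defining its complement, and these are among the finitely many primes associated
to that ideal.

Two choices keep the commutative algebra elementary. Associated primes of \<open>R/J\<close> are handled as colon
ideals \<open>(J : b)\<close> and take over the role of minimal primes over \<open>J\<close>. The principal ideal theorem and the
finite-length argument behind it are carried out in \<open>R\<close> itself: a statement about \<open>R\<^sub>p\<close> is expressed as a
statement that holds in \<open>R\<close> after multiplication by some \<open>u \<notin> p\<close>.\<close>

section \<open>Ideals and prime avoidance\<close>

locale noetherian_cring = cring R + noetherian_ring R for R (structure)

context cring
begin

text \<open>The annihilator of the class of \<open>b\<close> in \<open>R/J\<close>.\<close>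

definition colon :: "'a set \<Rightarrow> 'a \<Rightarrow> 'a set" where
  "colon J b = {r \<in> carrier R. r \<otimes> b \<in> J}"

text \<open>The associated primes of the module \<open>R/J\<close>, described by ideals of \<open>R\<close> alone.\<close>

definition assoc_primes :: "'a set \<Rightarrow> 'a set set" where
  "assoc_primes J = {p. primeideal p R \<and> (\<exists>b\<in>carrier R. p = colon J b)}"

definition adjoin :: "'a set \<Rightarrow> 'a \<Rightarrow> 'a set" where
  "adjoin J b = J <+>\<^bsub>R\<^esub> PIdl b"

lemma ideal_minus: "ideal J R \<Longrightarrow> x \<in> J \<Longrightarrow> y \<in> J \<Longrightarrow> x \<ominus> y \<in> J"
  unfolding a_minus_def
  by (meson additive_subgroup.a_closed additive_subgroup.a_inv_closed ideal.axioms(1))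

lemma ideal_add: "ideal J R \<Longrightarrow> x \<in> J \<Longrightarrow> y \<in> J \<Longrightarrow> x \<oplus> y \<in> J"
  by (meson additive_subgroup.a_closed ideal.axioms(1))

lemma ideal_zero: "ideal J R \<Longrightarrow> \<zero> \<in> J"
  by (meson additive_subgroup.zero_closed ideal.axioms(1))

lemma ideal_mult: "ideal J R \<Longrightarrow> x \<in> J \<Longrightarrow> r \<in> carrier R \<Longrightarrow> r \<otimes> x \<in> J"
  by (rule ideal.I_l_closed)

lemma ideal_carr: "ideal J R \<Longrightarrow> x \<in> J \<Longrightarrow> x \<in> carrier R"
  by (rule ideal.Icarr)

lemma primeideal_ideal: "primeideal p R \<Longrightarrow> ideal p R"
  by (rule primeideal.axioms(1))

lemma primeideal_one: "primeideal p R \<Longrightarrow> \<one> \<notin> p"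
  using ideal.one_imp_carrier primeideal.I_notcarr primeideal_ideal by blast

lemma primeideal_mult_notin:
  "primeideal p R \<Longrightarrow> x \<in> carrier R - p \<Longrightarrow> y \<in> carrier R - p \<Longrightarrow> x \<otimes> y \<in> carrier R - p"
  using primeideal.I_prime by fastforce

lemma primeideal_pow:
  assumes "primeideal p R" "x \<in> carrier R" "x [^] (n::nat) \<in> p"
  shows "x \<in> p"
  using assms(3)
proof (induction n)
  case 0
  then show ?case using primeideal_one[OF assms(1)] by simp
next
  case (Suc n)
  then show ?case using primeideal.I_prime[OF assms(1), of "x [^] n" x] assms(2) by auto
qed

lemma adjoin_iff:
  "b \<in> carrier R \<Longrightarrow> x \<in> adjoin J b \<longleftrightarrow> (\<exists>j\<in>J. \<exists>r\<in>carrier R. x = j \<oplus> r \<otimes> b)"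
  unfolding adjoin_def set_add_def' cgenideal_def by auto

lemma adjoin_ideal: "ideal J R \<Longrightarrow> b \<in> carrier R \<Longrightarrow> ideal (adjoin J b) R"
  unfolding adjoin_def by (intro add_ideals cgenideal_ideal)

lemma adjoin_subset:
  assumes "ideal J R" "b \<in> carrier R" shows "J \<subseteq> adjoin J b"
proof
  fix j assume "j \<in> J"
  then have "j = j \<oplus> \<zero> \<otimes> b" using ideal_carr[OF assms(1)] assms by simp
  then show "j \<in> adjoin J b" using \<open>j \<in> J\<close> adjoin_iff[OF assms(2)] by blast
qed

lemma adjoin_self:
  assumes "ideal J R" "b \<in> carrier R" shows "b \<in> adjoin J b"
proof -
  have "b = \<zero> \<oplus> \<one> \<otimes> b" using assms by simp
  then show ?thesis using ideal_zero[OF assms(1)] adjoin_iff[OF assms(2)] by blast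
qed

lemma adjoin_least: 
  assumes "ideal J R" "ideal K R" "J \<subseteq> K" "b \<in> K" shows "adjoin J b \<subseteq> K"
  using subsetD[OF assms(3)] ideal_add[OF assms(2)] ideal_mult[OF assms(2,4)]
  by (auto simp: adjoin_iff[OF ideal_carr[OF assms(2,4)]])

lemma idealI_closed:
  assumes "I \<subseteq> carrier R" "\<zero> \<in> I" "\<And>a b. a \<in> I \<Longrightarrow> b \<in> I \<Longrightarrow> a \<oplus> b \<in> I"
    and mult: "\<And>a r. a \<in> I \<Longrightarrow> r \<in> carrier R \<Longrightarrow> r \<otimes> a \<in> I"
  shows "ideal I R"
proof (rule idealI)
  show "ring R" by (rule ring_axioms)
  show "subgroup I (add_monoid R)"
  proof (rule group.subgroupI)
    show "group (add_monoid R)" by (rule add.is_group)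
    fix a assume a: "a \<in> I"
    then have "\<ominus> a = (\<ominus> \<one>) \<otimes> a" using assms(1) by (auto simp: l_minus)
    then have "\<ominus> a \<in> I" using mult[OF a, of "\<ominus> \<one>"] by simp
    then show "inv\<^bsub>add_monoid R\<^esub> a \<in> I" by (simp add: a_inv_def)
  qed (use assms in auto)
  fix a x assume *: "a \<in> I" "x \<in> carrier R"
  then show "x \<otimes> a \<in> I" by (rule mult)
  then show "a \<otimes> x \<in> I" using * assms(1) by (metis m_comm subsetD)
qed

lemma colon_ideal:
  assumes J: "ideal J R" and b: "b \<in> carrier R"
  shows "ideal (colon J b) R"
  using b ideal_zero[OF J] ideal_add[OF J] ideal_mult[OF J]
  by (intro idealI_closed) (auto simp: colon_def l_distr m_assoc)

lemma colon_mono_mult: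
  assumes "ideal J R" "b \<in> carrier R" "c \<in> carrier R"
  shows "colon J b \<subseteq> colon J (c \<otimes> b)"
  using assms ideal_mult[OF assms(1) _ assms(3)] by (auto simp: colon_def m_lcomm[OF _ assms(3,2)])

lemma colon_base: "ideal J R \<Longrightarrow> b \<in> carrier R \<Longrightarrow> J \<subseteq> colon J b"
  unfolding colon_def using ideal.I_r_closed ideal_carr by fastforce

lemma colon_one: "ideal J R \<Longrightarrow> colon J \<one> = J"
  unfolding colon_def using ideal_carr by fastforce

lemma assoc_primes_prime: "p \<in> assoc_primes J \<Longrightarrow> primeideal p R"
  by (simp add: assoc_primes_def)

lemma assoc_primes_superset: "ideal J R \<Longrightarrow> p \<in> assoc_primes J \<Longrightarrow> J \<subseteq> p"
  using colon_base by (auto simp: assoc_primes_def)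

lemma assoc_prime_zero_divisors:
  assumes "ideal J R" "p \<in> assoc_primes J"
  obtains b where "b \<in> carrier R" "b \<notin> J" "p = colon J b"
proof -
  obtain b where b: "b \<in> carrier R" "p = colon J b" using assms(2) by (auto simp: assoc_primes_def)
  have "\<one> \<notin> p" using assms(2) assoc_primes_prime primeideal_one by blast
  then have "b \<notin> J" using b by (auto simp: colon_def)
  then show ?thesis using that b by blast
qed

text \<open>As \<open>P\<close> is prime, a product of one factor outside \<open>P\<close> from \<open>I\<close> and from each member of \<open>G\<close> has the desired properties.\<close>

lemma prime_contains_factor_avoiding:
  assumes "finite G" "primeideal P R" "ideal I R" "\<not> I \<subseteq> P"
    and "\<And>Q. Q \<in> G \<Longrightarrow> ideal Q R \<and> \<not> Q \<subseteq> P"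
  shows "\<exists>y\<in>I. (\<forall>Q\<in>G. y \<in> Q) \<and> y \<notin> P"
  using assms(1,5)
proof (induction G)
  case empty
  then show ?case using assms(4) by blast
next
  case (insert Q G)
  then obtain y where y: "y \<in> I" "\<forall>Q\<in>G. y \<in> Q" "y \<notin> P" by blast
  obtain q where q: "q \<in> Q" "q \<notin> P" using insert.prems by blast
  have c: "q \<in> carrier R" "y \<in> carrier R" 
    using ideal_carr[OF _ q(1)] insert.prems ideal_carr[OF assms(3) y(1)] by auto
  have "q \<otimes> y \<in> I" using ideal_mult[OF assms(3) y(1) c(1)] .
  moreover have "q \<otimes> y \<in> Q" using insert.prems q c by (simp add: ideal.I_r_closed)
  moreover have "\<forall>Q\<in>G. q \<otimes> y \<in> Q" using insert.prems y(2) c by (auto intro: ideal_mult)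
  moreover have "q \<otimes> y \<notin> P" using primeideal.I_prime[OF assms(2) c] q y by blast
  ultimately show ?case by blast
qed

text \<open>Primes of \<open>F\<close> contained in others may be dropped, so \<open>F\<close> may be taken to be an antichain. Then an
  \<open>x\<close> avoiding all primes but \<open>P\<close> is corrected, if it lies in \<open>P\<close>, by some \<open>y \<in> I\<close> that
  lies in all the others but not in \<open>P\<close>.\<close>

theorem prime_avoidance:
  assumes "finite F" "ideal I R" "\<And>P. P \<in> F \<Longrightarrow> primeideal P R \<and> \<not> I \<subseteq> P"
  shows "\<exists>x\<in>I. \<forall>P\<in>F. x \<notin> P"
  using assms(1,3)
proof (induction F rule: finite_psubset_induct)
  case (psubset F)
  \<comment> \<open>Besides the trivial case: two comparable primes, or some \<open>P\<close> containing no other prime of \<open>F\<close>.\<close>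
  consider "F = {}" | P Q where "P \<in> F" "Q \<in> F" "P \<noteq> Q" "Q \<subseteq> P" 
    | P where "P \<in> F" "\<And>Q. Q \<in> F - {P} \<Longrightarrow> \<not> Q \<subseteq> P"
    by blast
  then show ?case
  proof cases
    case 1
    then show ?thesis using ideal_zero[OF assms(2)] by blast
  next
    case 2
    then have "\<exists>x\<in>I. \<forall>P\<in>F - {Q}. x \<notin> P" by (intro psubset.IH) (use psubset.prems in auto)
    then show ?thesis using 2 by blast
  next
    case 3
    then have "\<exists>x\<in>I. \<forall>Q\<in>F - {P}. x \<notin> Q" by (intro psubset.IH) (use psubset.prems in auto)
    then obtain x where x: "x \<in> I" "\<And>Q. Q \<in> F - {P} \<Longrightarrow> x \<notin> Q" by blast
    have "\<exists>y\<in>I. (\<forall>Q\<in>F - {P}. y \<in> Q) \<and> y \<notin> P"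
    proof (rule prime_contains_factor_avoiding)
      show "finite (F - {P})" using psubset.hyps by simp
      show "primeideal P R" "\<not> I \<subseteq> P" using psubset.prems 3(1) by auto
      show "ideal Q R \<and> \<not> Q \<subseteq> P" if "Q \<in> F - {P}" for Q
        using psubset.prems[of Q] 3(2)[OF that] that primeideal_ideal by auto
    qed (rule assms(2))
    then obtain y where y: "y \<in> I" "\<And>Q. Q \<in> F - {P} \<Longrightarrow> y \<in> Q" "y \<notin> P" by metis
    have c: "x \<in> carrier R" "y \<in> carrier R" using ideal_carr[OF assms(2)] x(1) y(1) by auto
    show ?thesis
    proof (cases "x \<in> P")
      case False
      then show ?thesis using x by blast
    next
      case True
      have "x \<oplus> y \<notin> Q" if Q: "Q \<in> F" for Q
      proof
        assume xy: "x \<oplus> y \<in> Q"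
        have iQ: "ideal Q R" using psubset.prems Q primeideal_ideal by blast
        have "y = x \<oplus> y \<ominus> x" "x = x \<oplus> y \<ominus> y" using c by algebra+
        then show False using ideal_minus[OF iQ xy] x y True Q by (metis DiffI singletonD)
      qed
      then show ?thesis using x y ideal_add[OF assms(2)] by blast
    qed
  qed
qed

end

section \<open>Associated primes of noetherian rings\<close>

context noetherian_cring
begin

lemma noetherian_maximal:
  assumes "P I\<^sub>0" "\<And>I. P I \<Longrightarrow> ideal I R"
  obtains M where "P M" "\<And>I. P I \<Longrightarrow> M \<subseteq> I \<Longrightarrow> I = M"
proof -
  have "\<exists>M\<in>Collect P. \<forall>I\<in>Collect P. M \<subseteq> I \<longrightarrow> I = M"
  proof (rule subset_Zorn_nonempty)
    show "Collect P \<noteq> {}" using assms(1) by blast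
    fix C assume C: "C \<noteq> {}" "subset.chain (Collect P) C"
    then have "subset.chain {I. ideal I R} C" using assms(2) by (auto simp: subset.chain_def)
    then show "\<Union>C \<in> Collect P"
      using ideal_chain_is_trivial[OF C(1)] C(2) by (auto simp: subset.chain_def)
  qed
  then show ?thesis using that by auto
qed

lemma noetherian_induct [consumes 1, case_names step]:
  assumes "ideal J R"
    and step: "\<And>J. ideal J R \<Longrightarrow> (\<And>J'. ideal J' R \<Longrightarrow> J \<subset> J' \<Longrightarrow> P J') \<Longrightarrow> P J"
  shows "P J"
proof (rule ccontr)
  assume "\<not> P J"
  then obtain M where M: "ideal M R \<and> \<not> P M" 
    and max: "\<And>I. ideal I R \<and> \<not> P I \<Longrightarrow> M \<subseteq> I \<Longrightarrow> I = M"
    using noetherian_maximal[of "\<lambda>I. ideal I R \<and> \<not> P I" J] assms(1) by blast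
  have "P M"
  proof (rule step)
    fix J' assume "ideal J' R" "M \<subset> J'"
    then show "P J'" using max[of J'] by auto
  qed (use M in simp)
  then show False using M by simp
qed

text \<open>Among the ideals \<open>(J : b)\<close> between \<open>(J : c)\<close> and \<open>p\<close> a maximal one is prime. If \<open>y z \<in> (J : b)\<close> and
  \<open>(J : y b) \<subseteq> p\<close>, maximality gives \<open>z \<in> (J : b)\<close>. Otherwise some \<open>v \<notin> p\<close> has \<open>v y b \<in> J\<close>; as
  \<open>(J : v b)\<close> is still inside \<open>p\<close>, maximality makes it equal to \<open>(J : b)\<close>, and it contains \<open>y\<close>.\<close>

lemma assoc_prime_within:
  assumes J: "ideal J R" and p: "primeideal p R" and c: "c \<in> carrier R" "colon J c \<subseteq> p"
  shows "\<exists>P\<in>assoc_primes J. colon J c \<subseteq> P \<and> P \<subseteq> p"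
proof -
  let ?P = "\<lambda>I. \<exists>b\<in>carrier R. I = colon J b \<and> colon J c \<subseteq> I \<and> I \<subseteq> p"
  obtain M where "?P M" and maxM: "\<And>I. ?P I \<Longrightarrow> M \<subseteq> I \<Longrightarrow> I = M"
    by (rule noetherian_maximal[of ?P "colon J c"]) (use c colon_ideal[OF J] in auto)
  then obtain b where b: "b \<in> carrier R" "colon J c \<subseteq> colon J b" "colon J b \<subseteq> p" "M = colon J b"
    by blast
  have max: "colon J b' = colon J b"
    if "b' \<in> carrier R" "colon J b \<subseteq> colon J b'" "colon J b' \<subseteq> p" for b'
    using maxM[of "colon J b'"] that b by auto
  have "primeideal (colon J b) R"
  proof (rule primeidealI)
    show "ideal (colon J b) R" by (rule colon_ideal[OF J b(1)])
    show "cring R" by (rule is_cring)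
    show "carrier R \<noteq> colon J b" using b(3) primeideal_one[OF p] by blast
    fix y z assume yz: "y \<in> carrier R" "z \<in> carrier R" "y \<otimes> z \<in> colon J b"
    show "y \<in> colon J b \<or> z \<in> colon J b"
    proof (cases "colon J (y \<otimes> b) \<subseteq> p")
      case True
      then have "colon J (y \<otimes> b) = colon J b"
        using max colon_mono_mult[OF J b(1) yz(1)] b yz by simp
      moreover have "z \<in> colon J (y \<otimes> b)" using yz b(1) by (simp add: colon_def m_ac)
      ultimately show ?thesis by blast
    next
      case False
      then obtain v where v: "v \<in> carrier R" "v \<otimes> (y \<otimes> b) \<in> J" "v \<notin> p" by (auto simp: colon_def)
      have "colon J (v \<otimes> b) \<subseteq> p"
      proof
        fix w assume w: "w \<in> colon J (v \<otimes> b)"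
        then have wc: "w \<in> carrier R" "w \<otimes> v \<in> colon J b" using v b(1) by (auto simp: colon_def m_assoc)
        then show "w \<in> p" using b(3) v primeideal.I_prime[OF p] by blast
      qed
      then have "colon J (v \<otimes> b) = colon J b"
        using max colon_mono_mult[OF J b(1) v(1)] b v by simp
      moreover have "y \<in> colon J (v \<otimes> b)" using yz v b(1) by (simp add: colon_def m_lcomm)
      ultimately show ?thesis by blast
    qed
  qed
  then show ?thesis using b by (auto simp: assoc_primes_def)
qed

text \<open>This replaces the choice of a minimal prime over \<open>J\<close> below \<open>p\<close>, with the advantage that the prime found consists of zero divisors modulo \<open>J\<close>.\<close>

lemma assoc_prime_below:
  assumes "ideal J R" "primeideal p R" "J \<subseteq> p"
  shows "\<exists>P\<in>assoc_primes J. P \<subseteq> p"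
  using assoc_prime_within[OF assms(1,2), of \<one>] colon_one[OF assms(1)] assms(3) by auto

lemma exists_assoc_prime:
  assumes J: "ideal J R" and "J \<noteq> carrier R"
  shows "assoc_primes J \<noteq> {}"
proof -
  let ?P = "\<lambda>I. ideal I R \<and> J \<subseteq> I \<and> I \<noteq> carrier R"
  obtain M where M: "?P M" and max: "\<And>I. ?P I \<Longrightarrow> M \<subseteq> I \<Longrightarrow> I = M"
    by (rule noetherian_maximal[of ?P J]) (use assms in auto)
  have "maximalideal M R"
  proof (rule maximalidealI)
    fix I assume "ideal I R" "M \<subseteq> I" "I \<subseteq> carrier R"
    then show "I = M \<or> I = carrier R" using max[of I] M by auto
  qed (use M in auto)
  then show ?thesis using assoc_prime_below[OF J maximalideal_prime] M by blast
qed

text \<open>Noetherian induction on \<open>J\<close>. For an associated prime \<open>P = (J : b)\<close> the exact sequence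
  \<open>0 \<rightarrow> R/P \<rightarrow> R/J \<rightarrow> R/(J + bR) \<rightarrow> 0\<close> shows that \<open>P\<close> is the only associated prime of \<open>R/J\<close> that is possibly not
  associated to \<open>R/(J + bR)\<close>.\<close>

theorem finite_assoc_primes: "ideal J R \<Longrightarrow> finite (assoc_primes J)"
proof (induction J rule: noetherian_induct)
  case (step J)
  note J = step(1)
  show ?case
  proof (cases "J = carrier R")
    case True
    have "assoc_primes J = {}"
      using True assoc_primes_superset[OF J] assoc_primes_prime primeideal_one by blast
    then show ?thesis by simp
  next
    case False
    then obtain P where P: "P \<in> assoc_primes J" using exists_assoc_prime[OF J] by blast
    then obtain b where b: "b \<in> carrier R" "b \<notin> J" "P = colon J b"
      using assoc_prime_zero_divisors[OF J] by blast
    have pP: "primeideal P R" using P assoc_primes_prime by blast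
    let ?J = "adjoin J b"
    have J': "ideal ?J R" using adjoin_ideal[OF J b(1)] .
    have "J \<subset> ?J" using adjoin_subset[OF J b(1)] adjoin_self[OF J b(1)] b(2) by blast
    then have fin: "finite (assoc_primes ?J)" using step.IH J' by blast
    have "Q \<in> insert P (assoc_primes ?J)" if Q: "Q \<in> assoc_primes J" for Q
    proof -
      have pQ: "primeideal Q R" using Q assoc_primes_prime by blast
      obtain c where c: "c \<in> carrier R" "Q = colon J c" using Q by (auto simp: assoc_primes_def)
      show ?thesis
      proof (cases "colon ?J c = colon J c")
        case True
        then show ?thesis using c pQ by (auto simp: assoc_primes_def)
      next
        case False
        then obtain r where r: "r \<in> carrier R" "r \<otimes> c \<in> ?J" "r \<otimes> c \<notin> J"
          using adjoin_subset[OF J b(1)] by (auto simp: colon_def)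
        then obtain j t where jt: "j \<in> J" "t \<in> carrier R" "r \<otimes> c = j \<oplus> t \<otimes> b"
          using adjoin_iff[OF b(1)] by blast
        have jc: "j \<in> carrier R" using jt J ideal_carr by blast
        have rQ: "r \<notin> Q" using r c by (simp add: colon_def)
        have tP: "t \<notin> P"
        proof
          assume "t \<in> P"
          then have "t \<otimes> b \<in> J" using b by (simp add: colon_def)
          then show False using r jt ideal_add[OF J] by simp
        qed
        \<comment> \<open>Here \<open>r c\<close> is a nonzero element of \<open>(J + bR)/J\<close>, which is isomorphic to \<open>R/P\<close>, so its annihilators \<open>Q\<close> and \<open>P\<close> agree.\<close>
        have key: "w \<in> Q \<longleftrightarrow> w \<in> P" if w: "w \<in> carrier R" for w
        proof -
          have "w \<in> Q \<longleftrightarrow> w \<otimes> r \<in> Q"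
            using rQ w r(1) primeideal.I_prime[OF pQ] ideal.I_r_closed[OF primeideal_ideal[OF pQ]] by blast
          also have "\<dots> \<longleftrightarrow> w \<otimes> (r \<otimes> c) \<in> J" using w r(1) c by (simp add: colon_def m_assoc)
          also have "\<dots> \<longleftrightarrow> w \<otimes> (t \<otimes> b) \<in> J"
          proof -
            have wj: "w \<otimes> j \<in> J" using ideal_mult[OF J jt(1) w] .
            have e: "w \<otimes> (r \<otimes> c) = w \<otimes> j \<oplus> w \<otimes> (t \<otimes> b)" "w \<otimes> (t \<otimes> b) = w \<otimes> (r \<otimes> c) \<ominus> w \<otimes> j"
              unfolding jt(3) using w jc jt(2) b(1) by algebra+
            show ?thesis using ideal_add[OF J wj] ideal_minus[OF J _ wj] e by metis
          qed
          also have "\<dots> \<longleftrightarrow> w \<otimes> t \<in> P" using w jt(2) b by (simp add: colon_def m_assoc)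
          also have "\<dots> \<longleftrightarrow> w \<in> P"
            using tP w jt(2) primeideal.I_prime[OF pP] ideal.I_r_closed[OF primeideal_ideal[OF pP]] by blast
          finally show ?thesis .
        qed
        have "Q = P" using key ideal_carr primeideal_ideal pP pQ by blast
        then show ?thesis by simp
      qed
    qed
    then show ?thesis using fin by (meson finite_insert finite_subset subsetI)
  qed
qed

text \<open>If every single element of \<open>q\<close> is a zero divisor on \<open>R\<^sub>q/J\<^sub>q\<close>, then \<open>q\<close> is covered by the finitely many associated
  primes inside \<open>q\<close>, and prime avoidance makes one of them equal to \<open>q\<close>.\<close>

lemma assoc_primesI_elementwise:
  assumes J: "ideal J R" and q: "primeideal q R"
    and zd: "\<And>y. y \<in> q \<Longrightarrow> \<exists>b\<in>carrier R. y \<otimes> b \<in> J \<and> colon J b \<subseteq> q"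
  shows "q \<in> assoc_primes J"
proof -
  let ?F = "{P \<in> assoc_primes J. P \<subseteq> q}"
  have cover: "\<exists>P\<in>?F. y \<in> P" if y: "y \<in> q" for y
  proof -
    obtain b where b: "b \<in> carrier R" "y \<otimes> b \<in> J" "colon J b \<subseteq> q" using zd[OF y] by blast
    have "y \<in> colon J b" using b y q primeideal_ideal ideal_carr by (auto simp: colon_def)
    then show ?thesis using assoc_prime_within[OF J q b(1,3)] by blast
  qed
  have fin: "finite ?F" using finite_assoc_primes[OF J] by simp
  have "\<exists>P\<in>?F. q \<subseteq> P"
  proof (rule ccontr)
    assume "\<not> ?thesis"
    then have "primeideal P R \<and> \<not> q \<subseteq> P" if "P \<in> ?F" for P
      using that assoc_primes_prime by blast
    then obtain x where "x \<in> q" "\<forall>P\<in>?F. x \<notin> P"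
      using prime_avoidance[OF fin primeideal_ideal[OF q]] by meson
    then show False using cover[of x] by blast
  qed
  then show ?thesis by auto
qed

end

section \<open>Krull's height theorem for one and two generators\<close>

context noetherian_cring
begin

text \<open>If \<open>p\<close> is minimal over \<open>J\<close>, then \<open>R\<^sub>p/J\<^sub>p\<close> has finite length, so descending chains of ideals above \<open>J\<close> become
  stationary after localization at \<open>p\<close>. The proof is a noetherian induction: unless \<open>J\<close> is not contained in \<open>p\<close> (where
  everything vanishes in \<open>R\<^sub>p\<close>), \<open>p = (J : b)\<close> is associated to \<open>R/J\<close>, and the layer between \<open>J\<close> and \<open>J + bR\<close> is
  \<open>R/p\<close>, which is simple at \<open>p\<close>. The chain stabilizes modulo \<open>J + bR\<close> by induction, and within this simple layer
  it either keeps containing a multiple \<open>t b\<close> with \<open>t \<notin> p\<close> or drops to \<open>J\<close>.\<close>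

lemma dcc_up_to_localization:
  assumes "ideal J R" and p: "primeideal p R"
    and "\<And>P. primeideal P R \<Longrightarrow> J \<subseteq> P \<Longrightarrow> P \<subseteq> p \<Longrightarrow> P = p"
    and "\<And>n::nat. ideal (I n) R" "\<And>n. I (Suc n) \<subseteq> I n" "\<And>n. J \<subseteq> I n"
  shows "\<exists>N. \<forall>n\<ge>N. \<forall>r\<in>I N. \<exists>u\<in>carrier R - p. u \<otimes> r \<in> I n"
  using assms(1,3-)
proof (induction J arbitrary: I rule: noetherian_induct)
  case (step J)
  note J = step.hyps and min = step.prems(1) and I = step.prems(2) and JI = step.prems(4)
  have dec: "I n \<subseteq> I m" if "m \<le> n" for m n
    using lift_Suc_antimono_le[of I, OF step.prems(3) that] .
  show ?case
  proof (cases "J \<subseteq> p")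
    case False
    then obtain u where u: "u \<in> J" "u \<notin> p" by blast
    then have uc: "u \<in> carrier R - p" using ideal_carr[OF J] by simp
    have "u \<otimes> r \<in> I n" if "r \<in> I 0" for r n
      using JI[of n] ideal.I_r_closed[OF J u(1)] ideal_carr[OF I that] by auto
    then show ?thesis using uc by blast
  next
    case True
    obtain P where P: "P \<in> assoc_primes J" "P \<subseteq> p" using assoc_prime_below[OF J p True] by blast
    have "P = p" using min[OF assoc_primes_prime[OF P(1)] assoc_primes_superset[OF J P(1)] P(2)] .
    then obtain b where b: "b \<in> carrier R" "b \<notin> J" "p = colon J b"
      using assoc_prime_zero_divisors[OF J P(1)] by metis
    let ?J = "adjoin J b"
    have J': "ideal ?J R" using adjoin_ideal[OF J b(1)] .
    have JJ': "J \<subset> ?J" using adjoin_subset[OF J b(1)] adjoin_self[OF J b(1)] b(2) by blast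
    let ?I = "\<lambda>n. I n <+>\<^bsub>R\<^esub> ?J"
    have I': "ideal (?I n) R" for n by (rule add_ideals[OF I J'])
    have "\<exists>N. \<forall>n\<ge>N. \<forall>r\<in>?I N. \<exists>u\<in>carrier R - p. u \<otimes> r \<in> ?I n"
    proof (rule step.IH[OF J' JJ'])
      show "P = p" if "primeideal P R" "?J \<subseteq> P" "P \<subseteq> p" for P
        using min[OF that(1) _ that(3)] that(2) JJ' by auto
      show "?I (Suc n) \<subseteq> ?I n" for n using dec[of n "Suc n"] unfolding set_add_def' by auto
      show "?J \<subseteq> ?I n" for n
      proof
        fix x assume "x \<in> ?J"
        moreover from this have "x = \<zero> \<oplus> x" using ideal_carr[OF J'] by simp
        ultimately show "x \<in> ?I n" using ideal_zero[OF I[of n]] unfolding set_add_def' by blast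
      qed
    qed (rule I')
    then obtain N1 where N1: "\<And>n r. n \<ge> N1 \<Longrightarrow> r \<in> ?I N1 \<Longrightarrow> \<exists>u\<in>carrier R - p. u \<otimes> r \<in> ?I n" by blast
    have split: "\<exists>u\<in>carrier R - p. \<exists>i\<in>I n. \<exists>j\<in>J. \<exists>t\<in>carrier R. u \<otimes> r = i \<oplus> j \<oplus> t \<otimes> b" 
      if n: "n \<ge> N1" and r: "r \<in> I N1" for n r
    proof -
      have "r = r \<oplus> \<zero>" using ideal_carr[OF I r] by simp
      then have "r \<in> ?I N1" using r ideal_zero[OF J'] unfolding set_add_def' by blast
      then obtain u where u: "u \<in> carrier R - p" "u \<otimes> r \<in> ?I n" using N1[OF n] by blast
      then obtain i k where ik: "i \<in> I n" "k \<in> ?J" "u \<otimes> r = i \<oplus> k" unfolding set_add_def' by blast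
      then obtain j t where jt: "j \<in> J" "t \<in> carrier R" "k = j \<oplus> t \<otimes> b" using adjoin_iff[OF b(1)] by blast
      have "u \<otimes> r = i \<oplus> j \<oplus> t \<otimes> b"
        using ik(3) jt ideal_carr[OF I ik(1)] ideal_carr[OF J jt(1)] b(1) by (simp add: a_assoc)
      then show ?thesis using u ik jt by blast
    qed
    show ?thesis
    proof (cases "\<forall>n. \<exists>t\<in>carrier R - p. t \<otimes> b \<in> I n")
      case True
      have "\<exists>u\<in>carrier R - p. u \<otimes> r \<in> I n" if n: "n \<ge> N1" and r: "r \<in> I N1" for n r
      proof -
        obtain u i j t where u: "u \<in> carrier R - p" "i \<in> I n" "j \<in> J" "t \<in> carrier R" "u \<otimes> r = i \<oplus> j \<oplus> t \<otimes> b"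
          using split[OF n r] by blast
        obtain w where w: "w \<in> carrier R - p" "w \<otimes> b \<in> I n" using True by blast
        have c: "u \<in> carrier R" "w \<in> carrier R" "i \<in> carrier R" "j \<in> carrier R" "r \<in> carrier R"
          using u w ideal_carr[OF I] ideal_carr[OF J] r by auto
        have "w \<otimes> u \<otimes> r = w \<otimes> (u \<otimes> r)" using c by (simp add: m_assoc)
        also have "\<dots> = (w \<otimes> i \<oplus> w \<otimes> j) \<oplus> t \<otimes> (w \<otimes> b)" unfolding u(5) using c u(4) b(1) by algebra
        finally have "w \<otimes> u \<otimes> r \<in> I n" 
          using ideal_add[OF I ideal_add[OF I ideal_mult[OF I u(2) c(2)]
              ideal_mult[OF I subsetD[OF JI u(3)] c(2)]] ideal_mult[OF I w(2) u(4)]] by simp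
        then show ?thesis using primeideal_mult_notin[OF p w(1) u(1)] by blast
      qed
      then show ?thesis by blast
    next
      case False
      then obtain N2 where N2: "\<And>t. t \<in> carrier R \<Longrightarrow> t \<otimes> b \<in> I N2 \<Longrightarrow> t \<in> p" by blast
      have "\<exists>u\<in>carrier R - p. u \<otimes> r \<in> I n" if n: "n \<ge> max N1 N2" and r: "r \<in> I (max N1 N2)" for n r
      proof -
        have r1: "r \<in> I N1" "r \<in> I N2" using r dec[of N1 "max N1 N2"] dec[of N2 "max N1 N2"] by auto
        obtain u i j t where u: "u \<in> carrier R - p" "i \<in> I n" "j \<in> J" "t \<in> carrier R" "u \<otimes> r = i \<oplus> j \<oplus> t \<otimes> b"
          using split[OF _ r1(1), of n] n by auto
        have c: "u \<in> carrier R" "i \<in> carrier R" "j \<in> carrier R" "r \<in> carrier R"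
          using u ideal_carr[OF I] ideal_carr[OF J] r by auto
        have i2: "i \<in> I N2" using u(2) dec[of N2 n] n by auto
        have j2: "j \<in> I m" for m using u(3) JI by blast
        have "t \<otimes> b = u \<otimes> r \<ominus> (i \<oplus> j)" unfolding u(5) using c u(4) b(1) by algebra
        then have "t \<otimes> b \<in> I N2"
          using ideal_minus[OF I ideal_mult[OF I r1(2) c(1)] ideal_add[OF I i2 j2]] by simp
        then have "t \<in> p" using N2 u(4) by blast
        then have "t \<otimes> b \<in> J" using b(3) by (simp add: colon_def)
        then have "t \<otimes> b \<in> I n" using JI by blast
        then have "u \<otimes> r \<in> I n" unfolding u(5) using ideal_add[OF I ideal_add[OF I]] u(2) j2 by blast
        then show ?thesis using u(1) by blast
      qed
      then show ?thesis by blast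
    qed
  qed
qed

text \<open>Nakayama's lemma for \<open>M\<^sub>p \<subseteq> N\<^sub>p + x M\<^sub>p\<close>. Replace \<open>N\<close> by an ideal \<open>K\<close> maximal among those over which the conclusion fails;
  adjoining a witness \<open>g\<close> of the failure to \<open>K\<close> yields an ideal that contains \<open>M\<close> at \<open>p\<close>, so \<open>g\<close> is, up to \<open>K\<close> and a factor outside \<open>p\<close>, a multiple
  of \<open>x g\<close>, and an element \<open>v u - a x\<close> with \<open>u, v \<notin> p\<close> is a unit at \<open>p\<close> because \<open>x \<in> p\<close>.\<close>

lemma nakayama_up_to_localization:
  assumes p: "primeideal p R" and x: "x \<in> p" and M: "ideal M R" and N: "ideal N R"
    and gen: "\<And>r. r \<in> M \<Longrightarrow> \<exists>u\<in>carrier R - p. \<exists>n\<in>N. \<exists>h\<in>M. u \<otimes> r = n \<oplus> x \<otimes> h"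
    and r: "r \<in> M"
  shows "\<exists>u\<in>carrier R - p. u \<otimes> r \<in> N"
proof (rule ccontr)
  assume contr: "\<not> ?thesis"
  let ?P = "\<lambda>K. ideal K R \<and> N \<subseteq> K \<and> (\<exists>r\<in>M. \<forall>u\<in>carrier R - p. u \<otimes> r \<notin> K)"
  have "?P N" using contr r N by blast
  then obtain K where PK: "?P K" and max: "\<And>I. ?P I \<Longrightarrow> K \<subseteq> I \<Longrightarrow> I = K"
    by (rule noetherian_maximal[of ?P N]) auto
  from PK obtain g where K: "ideal K R" "N \<subseteq> K" and g: "g \<in> M" "\<And>u. u \<in> carrier R - p \<Longrightarrow> u \<otimes> g \<notin> K"
    by blast
  have gc: "g \<in> carrier R" using g(1) M ideal_carr by blast
  have "\<one> \<in> carrier R - p" using primeideal_one[OF p] by simp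
  then have gK: "g \<notin> K" using g(2)[of \<one>] gc by auto
  have iK: "ideal (adjoin K g) R" by (rule adjoin_ideal[OF K(1) gc])
  have "adjoin K g \<noteq> K" using gK adjoin_self[OF K(1) gc] by auto
  then have "\<not> ?P (adjoin K g)" using max adjoin_subset[OF K(1) gc] by blast
  then have all: "\<exists>u\<in>carrier R - p. u \<otimes> r \<in> adjoin K g" if "r \<in> M" for r
    using that iK K(2) adjoin_subset[OF K(1) gc] by blast
  obtain u n h where u: "u \<in> carrier R - p" "n \<in> N" "h \<in> M" "u \<otimes> g = n \<oplus> x \<otimes> h" using gen[OF g(1)] by blast
  obtain v where v: "v \<in> carrier R - p" "v \<otimes> h \<in> adjoin K g" using all[OF u(3)] by blast
  then obtain k a where k: "k \<in> K" "a \<in> carrier R" "v \<otimes> h = k \<oplus> a \<otimes> g" using adjoin_iff[OF gc] by blast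
  note ip = primeideal_ideal[OF p]
  have c: "u \<in> carrier R" "v \<in> carrier R" "n \<in> carrier R" "h \<in> carrier R" "k \<in> carrier R" "x \<in> carrier R"
    using u(1) v(1) ideal_carr[OF N u(2)] ideal_carr[OF M u(3)] ideal_carr[OF K(1) k(1)] ideal_carr[OF ip x] by auto
  have "(v \<otimes> u \<ominus> a \<otimes> x) \<otimes> g = v \<otimes> (u \<otimes> g) \<ominus> x \<otimes> (a \<otimes> g)" using c k(2) gc by algebra
  also have "\<dots> = v \<otimes> n \<oplus> (x \<otimes> (v \<otimes> h) \<ominus> x \<otimes> (a \<otimes> g))" unfolding u(4) using c k(2) gc by algebra
  also have "\<dots> = v \<otimes> n \<oplus> x \<otimes> k" unfolding k(3) using c k(2) gc by algebra
  finally have *: "(v \<otimes> u \<ominus> a \<otimes> x) \<otimes> g \<in> K"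
    using ideal_add[OF K(1) ideal_mult[OF K(1)] ideal_mult[OF K(1)]] u(2) K(2) k(1) c by auto
  have "v \<otimes> u \<ominus> a \<otimes> x \<notin> p"
  proof
    assume "v \<otimes> u \<ominus> a \<otimes> x \<in> p"
    then have "(v \<otimes> u \<ominus> a \<otimes> x) \<oplus> a \<otimes> x \<in> p" by (rule ideal_add[OF ip]) (rule ideal_mult[OF ip x k(2)])
    moreover have "(v \<otimes> u \<ominus> a \<otimes> x) \<oplus> a \<otimes> x = v \<otimes> u" using c k(2) by algebra
    ultimately show False using primeideal_mult_notin[OF p v(1) u(1)] by simp
  qed
  then show False using g(2) * c k(2) by auto
qed

text \<open>Krull's principal ideal theorem for \<open>R/q\<^sub>0\<close>: below a prime \<open>p\<close> minimal over \<open>q\<^sub>0 + xR\<close> there is no room for a further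
  prime \<open>q\<^sub>1\<close>. Pick \<open>y \<in> q\<^sub>1\<close> outside \<open>q\<^sub>0\<close> and let \<open>S n\<close> be the contraction of the ideal \<open>(y\<^sup>n)\<close> of \<open>(R/q\<^sub>0)\<close> localized at
  \<open>q\<^sub>1\<close>; these take the place of the usual symbolic powers of \<open>q\<^sub>1\<close>. The chain of the \<open>S n + xR\<close> stabilizes at \<open>p\<close>. Since
  \<open>x \<notin> q\<^sub>1\<close> and \<open>S N\<close> is saturated at \<open>q\<^sub>1\<close>, this gives \<open>S N \<subseteq> S (N + 1) + x S N\<close> at \<open>p\<close>, hence \<open>S N = S (N + 1)\<close> at \<open>p\<close> by Nakayama.
  So \<open>y\<^sup>N\<close> is a multiple of \<open>y\<^bsup>N+1\<^esup>\<close> in the domain \<open>R/q\<^sub>0\<close> localized at \<open>q\<^sub>1\<close>, although \<open>y\<close> is a nonzero nonunit there.\<close>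

theorem principal_ideal_theorem:
  assumes q0: "primeideal q\<^sub>0 R" and q1: "primeideal q\<^sub>1 R" and p: "primeideal p R"
    and less: "q\<^sub>0 \<subset> q\<^sub>1" "q\<^sub>1 \<subset> p" and x: "x \<in> p"
    and min: "\<And>P. primeideal P R \<Longrightarrow> q\<^sub>0 \<subseteq> P \<Longrightarrow> x \<in> P \<Longrightarrow> P \<subseteq> p \<Longrightarrow> P = p"
  shows False
proof -
  note i0 = primeideal_ideal[OF q0] and i1 = primeideal_ideal[OF q1] and ip = primeideal_ideal[OF p]
  have xc: "x \<in> carrier R" using ideal_carr[OF ip x] .
  have xq: "x \<notin> q\<^sub>1" using min[OF q1] less by blast
  obtain y where y: "y \<in> q\<^sub>1" "y \<notin> q\<^sub>0" using less(1) by blast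
  have yc: "y \<in> carrier R" using ideal_carr[OF i1 y(1)] .
  define S where "S n = {r \<in> carrier R. \<exists>u\<in>carrier R - q\<^sub>1. u \<otimes> r \<in> adjoin q\<^sub>0 (y [^] n)}" for n :: nat
  have iA: "ideal (adjoin q\<^sub>0 (y [^] n)) R" for n :: nat using adjoin_ideal[OF i0] yc by simp
  have one: "\<one> \<in> carrier R - q\<^sub>1" using primeideal_one[OF q1] by simp
  have iS: "ideal (S n) R" for n
  proof (rule idealI_closed)
    show "S n \<subseteq> carrier R" by (auto simp: S_def)
    have "\<one> \<otimes> \<zero> \<in> adjoin q\<^sub>0 (y [^] n)" using ideal_zero[OF iA] by simp
    then show "\<zero> \<in> S n" using one unfolding S_def by blast
    fix a assume "a \<in> S n"
    then obtain u where u: "a \<in> carrier R" "u \<in> carrier R - q\<^sub>1" "u \<otimes> a \<in> adjoin q\<^sub>0 (y [^] n)" by (auto simp: S_def)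
    {
      fix b assume "b \<in> S n"
      then obtain v where v: "b \<in> carrier R" "v \<in> carrier R - q\<^sub>1" "v \<otimes> b \<in> adjoin q\<^sub>0 (y [^] n)" by (auto simp: S_def)
      have c: "u \<in> carrier R" "v \<in> carrier R" using u v by auto
      have "(u \<otimes> v) \<otimes> (a \<oplus> b) = v \<otimes> (u \<otimes> a) \<oplus> u \<otimes> (v \<otimes> b)" using u(1) v(1) c by algebra
      then have "(u \<otimes> v) \<otimes> (a \<oplus> b) \<in> adjoin q\<^sub>0 (y [^] n)"
        using ideal_add[OF iA ideal_mult[OF iA u(3) c(2)] ideal_mult[OF iA v(3) c(1)]] by simp
      then show "a \<oplus> b \<in> S n" 
        using u(1) v(1) primeideal_mult_notin[OF q1 u(2) v(2)] unfolding S_def by auto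
    next
      fix b assume b: "b \<in> carrier R"
      have "u \<otimes> (b \<otimes> a) \<in> adjoin q\<^sub>0 (y [^] n)" 
        using ideal_mult[OF iA u(3) b] u b by (simp add: m_lcomm)
      then show "b \<otimes> a \<in> S n" using u b by (auto simp: S_def)
    }
  qed
  have dec: "S (Suc n) \<subseteq> S n" for n
  proof -
    have "y [^] Suc n \<in> adjoin q\<^sub>0 (y [^] n)"
      using ideal.I_r_closed[OF iA adjoin_self[OF i0, of "y [^] n"] yc] yc by simp
    then have "adjoin q\<^sub>0 (y [^] Suc n) \<subseteq> adjoin q\<^sub>0 (y [^] n)"
      using adjoin_least[OF i0 iA adjoin_subset[OF i0, of "y [^] n"]] yc by simp
    then show ?thesis by (auto simp: S_def)
  qed
  have q0S: "q\<^sub>0 \<subseteq> S n" for n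
  proof
    fix a assume a: "a \<in> q\<^sub>0"
    then have "\<one> \<otimes> a \<in> adjoin q\<^sub>0 (y [^] n)" using adjoin_subset[OF i0, of "y [^] n"] ideal_carr[OF i0 a] yc by auto
    then show "a \<in> S n" using one ideal_carr[OF i0 a] unfolding S_def by blast
  qed
  let ?I = "\<lambda>n. adjoin (S n) x"
  have iI: "ideal (?I n) R" for n by (rule adjoin_ideal[OF iS xc])
  have "\<exists>N. \<forall>n\<ge>N. \<forall>r\<in>?I N. \<exists>u\<in>carrier R - p. u \<otimes> r \<in> ?I n"
  proof (rule dcc_up_to_localization[OF adjoin_ideal[OF i0 xc] p])
    show "P = p" if "primeideal P R" "adjoin q\<^sub>0 x \<subseteq> P" "P \<subseteq> p" for P
      using min[OF that(1) _ _ that(3)] that(2) adjoin_subset[OF i0 xc] adjoin_self[OF i0 xc] by blast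
    show "?I (Suc n) \<subseteq> ?I n" for n
      using adjoin_least[OF iS iI _ adjoin_self[OF iS xc]] adjoin_subset[OF iS xc] dec[of n] by blast
    show "adjoin q\<^sub>0 x \<subseteq> ?I n" for n
      using adjoin_least[OF i0 iI _ adjoin_self[OF iS xc]] adjoin_subset[OF iS xc] q0S[of n] by blast
  qed (rule iI)
  then obtain N where N: "\<And>n r. n \<ge> N \<Longrightarrow> r \<in> ?I N \<Longrightarrow> \<exists>u\<in>carrier R - p. u \<otimes> r \<in> ?I n" by blast
  have gen: "\<exists>u\<in>carrier R - p. \<exists>n\<in>S (Suc N). \<exists>h\<in>S N. u \<otimes> r = n \<oplus> x \<otimes> h" if r: "r \<in> S N" for r
  proof -
    have "r \<in> ?I N" using r adjoin_subset[OF iS xc] by blast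
    then obtain u where u: "u \<in> carrier R - p" "u \<otimes> r \<in> ?I (Suc N)" using N[of "Suc N"] by auto
    then obtain s t where st: "s \<in> S (Suc N)" "t \<in> carrier R" "u \<otimes> r = s \<oplus> t \<otimes> x" using adjoin_iff[OF xc] by blast
    have c: "s \<in> carrier R" "u \<in> carrier R" "r \<in> carrier R" using st(1) u(1) r by (auto simp: S_def)
    have "t \<otimes> x = u \<otimes> r \<ominus> s" unfolding st(3) using c st(2) xc by algebra
    then have "t \<otimes> x \<in> S N" using ideal_minus[OF iS ideal_mult[OF iS r c(2)]] st(1) dec[of N] by auto
    then obtain w where w: "w \<in> carrier R - q\<^sub>1" "w \<otimes> (t \<otimes> x) \<in> adjoin q\<^sub>0 (y [^] N)" by (auto simp: S_def)
    have "(w \<otimes> x) \<otimes> t \<in> adjoin q\<^sub>0 (y [^] N)" using w st(2) xc by (simp add: m_ac)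
    moreover have "w \<otimes> x \<in> carrier R - q\<^sub>1" using primeideal_mult_notin[OF q1 w(1)] xc xq by simp
    ultimately have "t \<in> S N" using st(2) unfolding S_def by blast
    moreover have "u \<otimes> r = s \<oplus> x \<otimes> t" using st xc by (simp add: m_comm)
    ultimately show ?thesis using u(1) st(1) by blast
  qed
  have "\<one> \<otimes> y [^] N \<in> adjoin q\<^sub>0 (y [^] N)" using adjoin_self[OF i0] yc by simp
  then have "y [^] N \<in> S N" using one yc unfolding S_def by blast
  then obtain u where u: "u \<in> carrier R - p" "u \<otimes> y [^] N \<in> S (Suc N)"
    using nakayama_up_to_localization[OF p x iS iS gen] by blast
  then obtain v where v: "v \<in> carrier R - q\<^sub>1" "v \<otimes> (u \<otimes> y [^] N) \<in> adjoin q\<^sub>0 (y [^] Suc N)" by (auto simp: S_def)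
  then obtain k c where k: "k \<in> q\<^sub>0" "c \<in> carrier R" "v \<otimes> (u \<otimes> y [^] N) = k \<oplus> c \<otimes> y [^] Suc N"
    using adjoin_iff[of "y [^] Suc N" _ q\<^sub>0] yc by blast
  have cc: "u \<in> carrier R" "v \<in> carrier R" "k \<in> carrier R" "y [^] N \<in> carrier R" using u v ideal_carr[OF i0 k(1)] yc by auto
  have "y [^] N \<otimes> (v \<otimes> u \<ominus> c \<otimes> y) = v \<otimes> (u \<otimes> y [^] N) \<ominus> c \<otimes> (y [^] N \<otimes> y)"
    using cc k(2) yc by algebra
  also have "\<dots> = k" unfolding k(3) using cc k(2) yc by (simp, algebra)
  finally have "y [^] N \<otimes> (v \<otimes> u \<ominus> c \<otimes> y) \<in> q\<^sub>0" using k(1) by simp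
  moreover have "v \<otimes> u \<ominus> c \<otimes> y \<in> carrier R" using cc k(2) yc by simp
  ultimately have "y [^] N \<in> q\<^sub>0 \<or> v \<otimes> u \<ominus> c \<otimes> y \<in> q\<^sub>0"
    using primeideal.I_prime[OF q0 cc(4)] by simp
  then have "v \<otimes> u \<ominus> c \<otimes> y \<in> q\<^sub>0" using primeideal_pow[OF q0 yc] y(2) by auto
  then have "v \<otimes> u \<ominus> c \<otimes> y \<in> q\<^sub>1" using less(1) by auto
  then have "(v \<otimes> u \<ominus> c \<otimes> y) \<oplus> c \<otimes> y \<in> q\<^sub>1" using ideal_add[OF i1 _ ideal_mult[OF i1 y(1) k(2)]] by simp
  moreover have "(v \<otimes> u \<ominus> c \<otimes> y) \<oplus> c \<otimes> y = v \<otimes> u" using cc k(2) yc by algebra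
  moreover have "v \<otimes> u \<in> carrier R - q\<^sub>1" using primeideal_mult_notin[OF q1 v(1)] u(1) less(2) by blast
  ultimately show False by simp
qed

text \<open>The chain of the ideals \<open>J + s\<^sup>n R\<close> stabilizes at \<open>p\<close>, so \<open>s\<^sup>N (u - c s) \<in> J\<close> for suitable \<open>N\<close>, \<open>u \<notin> p\<close> and \<open>c\<close>, and \<open>u - c s \<notin> p\<close> because \<open>s \<in> p\<close>.\<close>

lemma power_in_ideal_up_to_localization:
  assumes J: "ideal J R" and p: "primeideal p R" and s: "s \<in> p"
    and min: "\<And>P. primeideal P R \<Longrightarrow> J \<subseteq> P \<Longrightarrow> P \<subseteq> p \<Longrightarrow> P = p"
  shows "\<exists>n::nat. \<exists>u\<in>carrier R - p. u \<otimes> s [^] n \<in> J"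
proof -
  note ip = primeideal_ideal[OF p]
  have sc: "s \<in> carrier R" using ideal_carr[OF ip s] .
  let ?I = "\<lambda>n::nat. adjoin J (s [^] n)"
  have iI: "ideal (?I n) R" for n using adjoin_ideal[OF J] sc by simp
  have JI: "J \<subseteq> ?I n" for n using adjoin_subset[OF J] sc by simp
  have "\<exists>N. \<forall>n\<ge>N. \<forall>r\<in>?I N. \<exists>u\<in>carrier R - p. u \<otimes> r \<in> ?I n"
  proof (rule dcc_up_to_localization[OF J p min])
    show "?I (Suc n) \<subseteq> ?I n" for n
    proof (rule adjoin_least[OF J iI JI])
      show "s [^] Suc n \<in> ?I n"
        using ideal.I_r_closed[OF iI adjoin_self[OF J, of "s [^] n"] sc] sc by simp
    qed
  qed (use iI JI in auto)
  then obtain N where N: "\<And>n r. n \<ge> N \<Longrightarrow> r \<in> ?I N \<Longrightarrow> \<exists>u\<in>carrier R - p. u \<otimes> r \<in> ?I n" by blast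
  have "s [^] N \<in> ?I N" using adjoin_self[OF J] sc by simp
  then obtain u where u: "u \<in> carrier R - p" "u \<otimes> s [^] N \<in> ?I (Suc N)" using N[of "Suc N"] by auto
  then obtain j c where j: "j \<in> J" "c \<in> carrier R" "u \<otimes> s [^] N = j \<oplus> c \<otimes> s [^] Suc N"
    using adjoin_iff[of "s [^] Suc N" _ J] sc by blast
  have cc: "u \<in> carrier R" "j \<in> carrier R" "s [^] N \<in> carrier R" using u ideal_carr[OF J j(1)] sc by auto
  have "(u \<ominus> c \<otimes> s) \<otimes> s [^] N = u \<otimes> s [^] N \<ominus> c \<otimes> (s [^] N \<otimes> s)" using cc j(2) sc by algebra
  also have "\<dots> = j" unfolding j(3) using cc j(2) sc by (simp, algebra)
  finally have *: "(u \<ominus> c \<otimes> s) \<otimes> s [^] N \<in> J" using j(1) by simp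
  have "u \<ominus> c \<otimes> s \<notin> p"
  proof
    assume "u \<ominus> c \<otimes> s \<in> p"
    then have "(u \<ominus> c \<otimes> s) \<oplus> c \<otimes> s \<in> p" by (rule ideal_add[OF ip]) (rule ideal_mult[OF ip s j(2)])
    moreover have "(u \<ominus> c \<otimes> s) \<oplus> c \<otimes> s = u" using cc j(2) sc by algebra
    ultimately show False using u(1) by simp
  qed
  then show ?thesis using * cc j(2) sc by blast
qed

text \<open>As \<open>p\<close> is minimal over \<open>p\<^sub>2 + yR\<close>, some \<open>u x\<^sup>n\<close> with \<open>u \<notin> p\<close> equals \<open>z + r y\<close> with \<open>z \<in> p\<^sub>2\<close>, and \<open>p\<close> is minimal over \<open>(z, y)\<close> as well.
  The principal ideal theorem applied to \<open>y\<close> modulo a prime \<open>P\<close> with \<open>z \<in> P \<subset> p\<^sub>2\<close> rules out such \<open>P\<close>. So \<open>p\<^sub>2\<close> is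
  minimal over \<open>z\<close>, and a second application contradicts \<open>p\<^sub>0 \<subset> p\<^sub>1 \<subset> p\<^sub>2\<close>.\<close>

lemma two_generator_height_aux:
  assumes p0: "primeideal p\<^sub>0 R" and p1: "primeideal p\<^sub>1 R" and p2: "primeideal p\<^sub>2 R" and p: "primeideal p R"
    and less: "p\<^sub>0 \<subset> p\<^sub>1" "p\<^sub>1 \<subset> p\<^sub>2" "p\<^sub>2 \<subset> p" and xy: "x \<in> p" "y \<in> p" "y \<notin> p\<^sub>2"
    and max: "\<And>P. primeideal P R \<Longrightarrow> p\<^sub>2 \<subset> P \<Longrightarrow> P \<subseteq> p \<Longrightarrow> P = p"
    and min: "\<And>P. primeideal P R \<Longrightarrow> x \<in> P \<Longrightarrow> y \<in> P \<Longrightarrow> P \<subseteq> p \<Longrightarrow> P = p"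
  shows False
proof -
  note i2 = primeideal_ideal[OF p2] and ip = primeideal_ideal[OF p]
  have c: "x \<in> carrier R" "y \<in> carrier R" using ideal_carr[OF ip] xy by auto
  have "\<exists>n::nat. \<exists>u\<in>carrier R - p. u \<otimes> x [^] n \<in> adjoin p\<^sub>2 y"
  proof (rule power_in_ideal_up_to_localization[OF adjoin_ideal[OF i2 c(2)] p xy(1)])
    show "P = p" if "primeideal P R" "adjoin p\<^sub>2 y \<subseteq> P" "P \<subseteq> p" for P
      using max[OF that(1) _ that(3)] that(2) adjoin_subset[OF i2 c(2)] adjoin_self[OF i2 c(2)] xy(3) by blast
  qed
  then obtain n :: nat and u where u: "u \<in> carrier R - p" "u \<otimes> x [^] n \<in> adjoin p\<^sub>2 y" by blast
  then obtain z r where z: "z \<in> p\<^sub>2" "r \<in> carrier R" "u \<otimes> x [^] n = z \<oplus> r \<otimes> y" using adjoin_iff[OF c(2)] by blast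
  show False
  proof (rule principal_ideal_theorem[OF p0 p1 p2 less(1,2) z(1)])
    fix P assume P: "primeideal P R" "p\<^sub>0 \<subseteq> P" "z \<in> P" "P \<subseteq> p\<^sub>2"
    show "P = p\<^sub>2"
    proof (rule ccontr)
      assume "P \<noteq> p\<^sub>2"
      then have "P \<subset> p\<^sub>2" using P(4) by blast
      then show False
      proof (rule principal_ideal_theorem[OF P(1) p2 p _ less(3) xy(2)])
        fix Q assume Q: "primeideal Q R" "P \<subseteq> Q" "y \<in> Q" "Q \<subseteq> p"
        note iQ = primeideal_ideal[OF Q(1)]
        have "u \<otimes> x [^] n \<in> Q"
          unfolding z(3) using ideal_add[OF iQ _ ideal_mult[OF iQ Q(3) z(2)]] P(3) Q(2) by blast
        then have "x [^] n \<in> Q" using primeideal.I_prime[OF Q(1), of u "x [^] n"] u(1) Q(4) c by auto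
        then have "x \<in> Q" by (rule primeideal_pow[OF Q(1) c(1)])
        then show "Q = p" using min Q by blast
      qed
    qed
  qed
qed

text \<open>Krull's height theorem for two generators. The prime below \<open>p\<close> is enlarged to be maximal below \<open>p\<close>; it misses \<open>x\<close> or \<open>y\<close>.\<close>

theorem two_generator_height:
  assumes p0: "primeideal p\<^sub>0 R" and p1: "primeideal p\<^sub>1 R" and p2: "primeideal p\<^sub>2 R" and p: "primeideal p R"
    and less: "p\<^sub>0 \<subset> p\<^sub>1" "p\<^sub>1 \<subset> p\<^sub>2" "p\<^sub>2 \<subset> p" and xy: "x \<in> p" "y \<in> p"
    and min: "\<And>P. primeideal P R \<Longrightarrow> x \<in> P \<Longrightarrow> y \<in> P \<Longrightarrow> P \<subseteq> p \<Longrightarrow> P = p"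
  shows False
proof -
  let ?P = "\<lambda>P. primeideal P R \<and> p\<^sub>2 \<subseteq> P \<and> P \<subset> p"
  have "?P p\<^sub>2" using p2 less(3) by blast
  then obtain q where q': "?P q" and maxq: "\<And>P. ?P P \<Longrightarrow> q \<subseteq> P \<Longrightarrow> P = q"
    by (rule noetherian_maximal[of ?P p\<^sub>2]) (auto intro: primeideal_ideal)
  then have q: "primeideal q R" "p\<^sub>2 \<subseteq> q" "q \<subset> p" by simp_all
  have max: "P = p" if "primeideal P R" "q \<subset> P" "P \<subseteq> p" for P
    using maxq[of P] that q(2) by auto
  have l: "p\<^sub>1 \<subset> q" using less q by blast
  have "x \<notin> q \<or> y \<notin> q" using min[OF q(1)] q(3) by blast
  then show False
  proof
    assume "y \<notin> q"
    then show False using two_generator_height_aux[OF p0 p1 q(1) p less(1) l q(3) xy _ max min] by blast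
  next
    assume "x \<notin> q"
    then show False using two_generator_height_aux[OF p0 p1 q(1) p less(1) l q(3) xy(2,1) _ max] min by blast
  qed
qed

end

section \<open>Height, regular sequences and grade\<close>

text \<open>Extended naturals below \<open>n > 0\<close> are at most \<open>n - 1\<close>, and so is the supremum of a set of them. This turns lower bounds on heights and grades into existence statements.\<close>

lemma enat_le_Sup_iff:
  assumes "n \<noteq> 0"
  shows "enat n \<le> Sup A \<longleftrightarrow> (\<exists>x\<in>A. enat n \<le> x)"
proof
  assume le: "enat n \<le> Sup A"
  show "\<exists>x\<in>A. enat n \<le> x"
  proof (rule ccontr)
    assume *: "\<not> ?thesis"
    have "Sup A \<le> enat (n - 1)"
    proof (rule Sup_least)
      fix x assume "x \<in> A"
      then have "x < enat n" using * by auto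
      then show "x \<le> enat (n - 1)" using assms by (cases x) auto
    qed
    with le have "enat n \<le> enat (n - 1)" by (rule order_trans)
    then show False using assms by simp
  qed
qed (auto intro: Sup_upper2)

lemma height_ge_iff:
  "enat n \<le> height R p \<longleftrightarrow> (\<exists>c. length c = n \<and> set c \<subseteq> Spec R \<and> sorted_wrt (\<subset>) (c @ [p]))"
proof (cases "n = 0")
  case True
  then show ?thesis by (simp add: zero_enat_def[symmetric])
next
  case False
  have "enat n \<le> height R p \<longleftrightarrow> (\<exists>c. n \<le> length c \<and> set c \<subseteq> Spec R \<and> sorted_wrt (\<subset>) (c @ [p]))"
    unfolding height_def enat_le_Sup_iff[OF False] by (auto 4 3 simp flip: enat_ord_simps(1))
  also have "\<dots> \<longleftrightarrow> (\<exists>c. length c = n \<and> set c \<subseteq> Spec R \<and> sorted_wrt (\<subset>) (c @ [p]))"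
  proof
    assume "\<exists>c. n \<le> length c \<and> set c \<subseteq> Spec R \<and> sorted_wrt (\<subset>) (c @ [p])"
    then obtain c where c: "n \<le> length c" "set c \<subseteq> Spec R" "sorted_wrt (\<subset>) (c @ [p])" by blast
    let ?c = "drop (length c - n) c"
    have "sorted_wrt (\<subset>) (?c @ [p])"
      using sorted_wrt_drop[OF c(3), of "length c - n"] by simp
    moreover have "set ?c \<subseteq> Spec R" using c(2) set_drop_subset by fastforce
    moreover have "length ?c = n" using c(1) by simp
    ultimately show "\<exists>c. length c = n \<and> set c \<subseteq> Spec R \<and> sorted_wrt (\<subset>) (c @ [p])" by blast
  qed auto
  finally show ?thesis .
qed

lemma height_Suc_iff:
  "enat (Suc n) \<le> height R p \<longleftrightarrow> (\<exists>q\<in>Spec R. q \<subset> p \<and> enat n \<le> height R q)"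
proof
  assume "enat (Suc n) \<le> height R p"
  then obtain c where c: "length c = Suc n" "set c \<subseteq> Spec R" "sorted_wrt (\<subset>) (c @ [p])"
    unfolding height_ge_iff by blast
  obtain d q where d: "c = d @ [q]" using c(1) by (cases c rule: rev_cases) auto
  have "sorted_wrt (\<subset>) (d @ [q])" "q \<subset> p" "q \<in> Spec R" "set d \<subseteq> Spec R" "length d = n"
    using c unfolding d by (auto simp: sorted_wrt_append)
  then show "\<exists>q\<in>Spec R. q \<subset> p \<and> enat n \<le> height R q"
    using height_ge_iff[of n R q] by blast
next
  assume "\<exists>q\<in>Spec R. q \<subset> p \<and> enat n \<le> height R q"
  then obtain q c where c: "q \<in> Spec R" "q \<subset> p" "length c = n" "set c \<subseteq> Spec R" "sorted_wrt (\<subset>) (c @ [q])"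
    unfolding height_ge_iff by blast
  then have "sorted_wrt (\<subset>) ((c @ [q]) @ [p])" by (auto simp: sorted_wrt_append)
  moreover have "length (c @ [q]) = Suc n" "set (c @ [q]) \<subseteq> Spec R" using c by auto
  ultimately show "enat (Suc n) \<le> height R p"
    using height_ge_iff[of "Suc n" R p] by blast
qed

lemma enat_not_Suc_le: "\<not> enat (Suc n) \<le> h \<longleftrightarrow> h \<le> enat n"
  by (cases h) auto

lemma height_mono_strict:
  assumes "q \<in> Spec R" "q \<subset> p" "enat n \<le> height R q" shows "enat (Suc n) \<le> height R p"
  using assms unfolding height_Suc_iff by blast

lemma height_le_krull_dim: "p \<in> Spec R \<Longrightarrow> height R p \<le> krull_dim R"
  unfolding krull_dim_def by (rule SUP_upper)

lemma height_mono:
  assumes "q \<in> Spec R" "q \<subseteq> p" shows "height R q \<le> height R p"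
proof (cases "q = p")
  case False
  show ?thesis
    unfolding height_def[of R q]
  proof (rule Sup_least)
    fix x assume "x \<in> {enat (length c) |c. set c \<subseteq> Spec R \<and> sorted_wrt (\<subset>) (c @ [q])}"
    then obtain c where c: "x = enat (length c)" "set c \<subseteq> Spec R" "sorted_wrt (\<subset>) (c @ [q])" by blast
    then have "x \<le> height R q" using height_ge_iff[of "length c" R q] by blast
    then have "enat (Suc (length c)) \<le> height R p"
      using c(1) assms False by (intro height_mono_strict[of q]) auto
    then show "x \<le> height R p" unfolding c(1) by (rule order_trans[rotated]) simp
  qed
qed simp

lemma enat_eqI: 
  fixes x y :: enat
  assumes "\<And>n. enat n \<le> x \<longleftrightarrow> enat n \<le> y" shows "x = y"
proof (cases x)
  case (enat k)
  then have "enat k \<le> y" "\<not> enat (Suc k) \<le> y" using assms[of k] assms[of "Suc k"] by auto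
  then show ?thesis using enat by (cases y) auto
next
  case infinity
  then have *: "\<And>n. enat n \<le> y" using assms by auto
  show ?thesis using infinity *[of "Suc (the_enat y)"] by (cases y) auto
qed

context cring
begin

lemma Idl_empty: "Idl {} = {\<zero>}"
proof
  show "Idl {} \<subseteq> {\<zero>}" using genideal_minimal[OF zeroideal, of "{}"] by simp
  show "{\<zero>} \<subseteq> Idl {}" using ideal_zero[OF genideal_ideal[of "{}"]] by simp
qed

lemma PIdl_iff: "x \<in> PIdl a \<longleftrightarrow> (\<exists>r\<in>carrier R. x = r \<otimes> a)"
  by (auto simp: cgenideal_def)

lemma rcos_eq_iff_mem:
  assumes "ideal J R" "z \<in> carrier R"
  shows "J +> z = J \<longleftrightarrow> z \<in> J"
proof -
  interpret ideal J R by fact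
  show ?thesis using a_rcos_self[of z] a_rcos_const[of z] assms(2) by auto
qed

lemma nonzerodivisors_quot_iff:
  assumes J: "ideal J R" and x: "x \<in> carrier R"
  shows "J +> x \<in> nonzerodivisors (R Quot J) \<longleftrightarrow> (\<forall>b\<in>carrier R. x \<otimes> b \<in> J \<longrightarrow> b \<in> J)"
proof -
  interpret ideal J R by fact
  have carr: "carrier (R Quot J) = (\<lambda>b. J +> b) ` carrier R"
    by (auto simp: FactRing_simps)
  have mult: "(J +> x) \<otimes>\<^bsub>R Quot J\<^esub> (J +> b) = J +> (x \<otimes> b)" if "b \<in> carrier R" for b
    using rcoset_mult_add[OF x that] by (simp add: FactRing_def)
  have zero: "\<zero>\<^bsub>R Quot J\<^esub> = J" by (simp add: FactRing_def)
  show ?thesis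
    unfolding nonzerodivisors_def mem_Collect_eq carr zero
    using x by (auto simp: mult rcos_eq_iff_mem[OF J])
qed

text \<open>Regularity of a sequence without mention of quotient rings.\<close>

lemma regular_sequence_iff:
  "regular_sequence R xs \<longleftrightarrow> set xs \<subseteq> carrier R \<and> Idl (set xs) \<noteq> carrier R \<and>
    (\<forall>i<length xs. \<forall>b\<in>carrier R. xs ! i \<otimes> b \<in> Idl (set (take i xs)) \<longrightarrow> b \<in> Idl (set (take i xs)))"
proof (cases "set xs \<subseteq> carrier R")
  case True
  have "Idl (set (take i xs)) +> xs ! i \<in> nonzerodivisors (R Quot Idl (set (take i xs))) \<longleftrightarrow>
     (\<forall>b\<in>carrier R. xs ! i \<otimes> b \<in> Idl (set (take i xs)) \<longrightarrow> b \<in> Idl (set (take i xs)))"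
    if "i < length xs" for i
  proof (rule nonzerodivisors_quot_iff)
    show "ideal (Idl (set (take i xs))) R"
      using True set_take_subset[of i xs] by (intro genideal_ideal) blast
    show "xs ! i \<in> carrier R" using True that by auto
  qed
  then show ?thesis unfolding regular_sequence_def Let_def by auto
qed (simp add: regular_sequence_def)

lemma regular_sequence_append:
  assumes "regular_sequence R (xs @ ys)" shows "regular_sequence R xs"
proof -
  have *: "set xs \<union> set ys \<subseteq> carrier R" "Idl (set xs \<union> set ys) \<noteq> carrier R"
    and reg: "\<And>i b. i < length (xs @ ys) \<Longrightarrow> b \<in> carrier R \<Longrightarrow> (xs @ ys) ! i \<otimes> b \<in> Idl (set (take i (xs @ ys)))
      \<Longrightarrow> b \<in> Idl (set (take i (xs @ ys)))"
    using assms unfolding regular_sequence_iff by auto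
  have "Idl (set xs) \<subseteq> Idl (set xs \<union> set ys)"
    using * subset_Idl_subset[of "set xs \<union> set ys" "set xs"] by blast
  then have "Idl (set xs) \<noteq> carrier R"
    using * ideal_carr[OF genideal_ideal[OF *(1)]] by blast
  moreover have "b \<in> Idl (set (take i xs))"
    if "i < length xs" "b \<in> carrier R" "xs ! i \<otimes> b \<in> Idl (set (take i xs))" for i b
    using reg[of i b] that by (simp add: nth_append)
  ultimately show ?thesis unfolding regular_sequence_iff using *(1) by simp
qed

lemma regular_sequence_snoc:
  assumes "regular_sequence R (xs @ [x])"
  shows "x \<in> carrier R" and "\<And>b. b \<in> carrier R \<Longrightarrow> x \<otimes> b \<in> Idl (set xs) \<Longrightarrow> b \<in> Idl (set xs)"
  using assms unfolding regular_sequence_iff by (auto dest: spec[of _ "length xs"])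

lemma regular_sequence_singleton:
  "regular_sequence R [x] \<longleftrightarrow> x \<in> nonzerodivisors R \<and> PIdl x \<noteq> carrier R"
proof -
  have "x \<in> carrier R \<Longrightarrow> Idl {x} = PIdl x" using cgenideal_eq_genideal by simp
  then show ?thesis
    unfolding regular_sequence_iff by (auto simp: Idl_empty nonzerodivisors_def)
qed

lemma regular_sequence_pair:
  "regular_sequence R [x, y] \<longleftrightarrow> x \<in> nonzerodivisors R \<and> y \<in> carrier R \<and> Idl {x, y} \<noteq> carrier R \<and>
     (\<forall>b\<in>carrier R. y \<otimes> b \<in> PIdl x \<longrightarrow> b \<in> PIdl x)"
proof -
  have "x \<in> carrier R \<Longrightarrow> Idl {x} = PIdl x" using cgenideal_eq_genideal by simp
  then show ?thesis
    unfolding regular_sequence_iff by (auto simp: Idl_empty nonzerodivisors_def less_Suc_eq all_conj_distrib)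
qed

lemma grade_ge_iff:
  assumes "n \<noteq> 0"
  shows "enat n \<le> grade R I \<longleftrightarrow> (\<exists>xs. length xs = n \<and> set xs \<subseteq> I \<and> regular_sequence R xs)"
proof -
  have "enat n \<le> grade R I \<longleftrightarrow> (\<exists>xs. n \<le> length xs \<and> set xs \<subseteq> I \<and> regular_sequence R xs)"
    unfolding grade_def enat_le_Sup_iff[OF assms] by (auto 4 3 simp flip: enat_ord_simps(1))
  also have "\<dots> \<longleftrightarrow> (\<exists>xs. length xs = n \<and> set xs \<subseteq> I \<and> regular_sequence R xs)"
  proof
    assume "\<exists>xs. n \<le> length xs \<and> set xs \<subseteq> I \<and> regular_sequence R xs"
    then obtain xs where xs: "n \<le> length xs" "set xs \<subseteq> I" "regular_sequence R xs" by blast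
    have "regular_sequence R (take n xs)" 
      using regular_sequence_append[of "take n xs" "drop n xs"] xs(3) by simp
    moreover have "set (take n xs) \<subseteq> I" using xs(2) set_take_subset by fastforce
    ultimately show "\<exists>xs. length xs = n \<and> set xs \<subseteq> I \<and> regular_sequence R xs"
      using xs(1) by (intro exI[of _ "take n xs"]) auto
  qed auto
  finally show ?thesis .
qed

lemma grade_mono: "I \<subseteq> J \<Longrightarrow> grade R I \<le> grade R J"
  unfolding grade_def by (rule Sup_subset_mono) blast

lemma prime_principal_proper:
  assumes "primeideal p R" "s \<in> p" shows "PIdl s \<noteq> carrier R"
  using cgenideal_minimal[OF primeideal_ideal[OF assms(1)] assms(2)] primeideal_one[OF assms(1)] by blast

lemma grade_ge_1_iff:
  assumes "primeideal p R"
  shows "enat 1 \<le> grade R p \<longleftrightarrow> p \<inter> nonzerodivisors R \<noteq> {}"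
proof -
  have "enat 1 \<le> grade R p \<longleftrightarrow> (\<exists>xs. length xs = 1 \<and> set xs \<subseteq> p \<and> regular_sequence R xs)"
    by (rule grade_ge_iff) simp
  also have "\<dots> \<longleftrightarrow> (\<exists>x. set [x] \<subseteq> p \<and> regular_sequence R [x])"
    by (auto simp: length_Suc_conv)
  also have "\<dots> \<longleftrightarrow> p \<inter> nonzerodivisors R \<noteq> {}"
    using prime_principal_proper[OF assms] by (auto simp: regular_sequence_singleton)
  finally show ?thesis .
qed

text \<open>Let \<open>p = (sR : a)\<close> and let \<open>x, y\<close> be a regular sequence in \<open>p\<close>. Write \<open>x a = b s\<close>. Then \<open>b \<notin> xR\<close>, since otherwise \<open>a \<in> sR\<close>, but
  \<open>y a \<in> sR\<close> gives \<open>y b \<in> xR\<close> after cancelling \<open>s\<close>, so \<open>y\<close> is a zero divisor modulo \<open>x\<close>.\<close>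

lemma grade_assoc_prime_principal:
  assumes s: "s \<in> nonzerodivisors R" and p: "p \<in> assoc_primes (PIdl s)"
  shows "grade R p = enat 1"
proof -
  have sc: "s \<in> carrier R" using s by (simp add: nonzerodivisors_def)
  note iS = cgenideal_ideal[OF sc]
  have pp: "primeideal p R" using p assoc_primes_prime by blast
  obtain a where a: "a \<in> carrier R" "a \<notin> PIdl s" "p = colon (PIdl s) a"
    using assoc_prime_zero_divisors[OF iS p] by blast
  have "s \<in> p" using assoc_primes_superset[OF iS p] cgenideal_self[OF sc] by blast
  then have ge: "enat 1 \<le> grade R p" using s grade_ge_1_iff[OF pp] by blast
  have "\<not> enat 2 \<le> grade R p"
  proof
    assume "enat 2 \<le> grade R p"
    then obtain xs where xs: "length xs = 2" "set xs \<subseteq> p" "regular_sequence R xs"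
      using grade_ge_iff[of 2 p] by auto
    then obtain x y where xy: "xs = [x, y]" by (auto simp: numeral_2_eq_2 length_Suc_conv)
    note reg' = xs(3)[unfolded xy regular_sequence_pair]
    have x: "x \<in> p" "y \<in> p" "x \<in> nonzerodivisors R" using xs(2) reg' by (simp_all add: xy)
    have reg: "b \<in> carrier R \<Longrightarrow> y \<otimes> b \<in> PIdl x \<Longrightarrow> b \<in> PIdl x" for b
      using reg' by blast
    have c: "x \<in> carrier R" "y \<in> carrier R" using x ideal_carr[OF primeideal_ideal[OF pp]] by auto
    have cancel: "u = v" if "w \<in> nonzerodivisors R" "w \<otimes> u = w \<otimes> v" "u \<in> carrier R" "v \<in> carrier R" for u v w
    proof -
      have "w \<in> carrier R" using that by (simp add: nonzerodivisors_def)
      then have "w \<otimes> (u \<ominus> v) = \<zero>" using that by (simp add: a_minus_def r_distr r_minus r_neg)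
      then have "u \<ominus> v = \<zero>" using that by (auto simp: nonzerodivisors_def)
      then show ?thesis using that by simp
    qed
    obtain b where b: "b \<in> carrier R" "x \<otimes> a = b \<otimes> s" using x(1) a(3) by (auto simp: colon_def PIdl_iff)
    obtain d where d: "d \<in> carrier R" "y \<otimes> a = d \<otimes> s" using x(2) a(3) by (auto simp: colon_def PIdl_iff)
    have "s \<otimes> (y \<otimes> b) = y \<otimes> (b \<otimes> s)" using c sc b(1) by algebra
    also have "\<dots> = x \<otimes> (y \<otimes> a)" unfolding b(2)[symmetric] using c a(1) by algebra
    also have "\<dots> = s \<otimes> (d \<otimes> x)" unfolding d(2) using c d(1) sc by algebra
    finally have "y \<otimes> b = d \<otimes> x" using cancel[OF s] b(1) c d(1) by simp
    then have "b \<in> PIdl x" using reg[OF b(1)] d(1) by (auto simp: PIdl_iff)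
    then obtain e where e: "e \<in> carrier R" "b = e \<otimes> x" by (auto simp: PIdl_iff)
    have "x \<otimes> a = x \<otimes> (e \<otimes> s)" unfolding b(2) e(2) using e(1) c sc by algebra
    then have "a = e \<otimes> s" using cancel[OF x(3)] a(1) e(1) sc by simp
    then show False using a(2) e(1) by (auto simp: PIdl_iff)
  qed
  then have "grade R p \<le> enat 1" using enat_not_Suc_le[of 1] by (simp add: numeral_2_eq_2)
  then show ?thesis using ge by (rule antisym)
qed

end

context noetherian_cring
begin

text \<open>Below \<open>p\<close> there is an associated prime \<open>P\<close> of \<open>R\<close> modulo all but the last member of the sequence. It consists of zero
  divisors and so misses the last member, whence \<open>P \<subset> p\<close>, and induction applies to \<open>P\<close>.\<close>

lemma height_ge_length_regular_sequence:
  assumes "regular_sequence R xs" "primeideal p R" "set xs \<subseteq> p"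
  shows "enat (length xs) \<le> height R p"
  using assms
proof (induction xs arbitrary: p rule: rev_induct)
  case Nil
  then show ?case by (simp add: zero_enat_def[symmetric])
next
  case (snoc x xs)
  note p = snoc.prems(2)
  have xs: "set xs \<subseteq> p" "set xs \<subseteq> carrier R" "x \<in> p"
    using snoc.prems(3) ideal_carr[OF primeideal_ideal[OF p]] by auto
  let ?J = "Idl (set xs)"
  have J: "ideal ?J R" using genideal_ideal[OF xs(2)] .
  have "?J \<subseteq> p" using genideal_minimal[OF primeideal_ideal[OF p] xs(1)] .
  then obtain P where P: "P \<in> assoc_primes ?J" "P \<subseteq> p" using assoc_prime_below[OF J p] by blast
  obtain b where b: "b \<in> carrier R" "b \<notin> ?J" "P = colon ?J b"
    using assoc_prime_zero_divisors[OF J P(1)] by blast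
  have "x \<notin> P" using regular_sequence_snoc[OF snoc.prems(1)] b by (auto simp: colon_def)
  then have "P \<subset> p" using P(2) xs(3) by blast
  moreover have pP: "primeideal P R" using P(1) by (rule assoc_primes_prime)
  moreover have "set xs \<subseteq> P" using assoc_primes_superset[OF J P(1)] genideal_self[OF xs(2)] by blast
  then have "enat (length xs) \<le> height R P"
    using snoc.IH[OF regular_sequence_append[OF snoc.prems(1)] pP] by blast
  ultimately show ?case using height_mono_strict[of P R p] by (simp add: Spec_def)
qed

lemma grade_le_height: "primeideal p R \<Longrightarrow> grade R p \<le> height R p"
  unfolding grade_def using height_ge_length_regular_sequence by (intro Sup_least) auto

end

section \<open>Localization at a prime\<close>

context cring
begin

lemma fraction_eq_iff:
  assumes S: "submonoid S R" and c: "a \<in> carrier R" "b \<in> carrier R" "s \<in> S" "t \<in> S"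
  shows "fraction R S a s = fraction R S b t \<longleftrightarrow> (\<exists>u\<in>S. u \<otimes> (t \<otimes> a \<ominus> s \<otimes> b) = \<zero>)"
proof -
  have "fraction R S a s = fraction R S b t \<longleftrightarrow> ((a, s), (b, t)) \<in> loc_rel R S"
    unfolding fraction_def using c by (intro eq_equiv_class_iff[OF equiv_loc_rel[OF S]]) auto
  then show ?thesis using c by (simp add: loc_rel_def)
qed

end

text \<open>Ideals of \<open>L = R\<^sub>p\<close> are determined by their contractions to \<open>R\<close>, and contraction is an order isomorphism from the primes of
  \<open>L\<close> onto the primes of \<open>R\<close> inside \<open>p\<close>. Noetherianity, the unique maximal ideal and the dimension of \<open>L\<close> are read off from this.\<close>

locale localization_at_prime = noetherian_cring R for R (structure) +
  fixes p assumes prime: "primeideal p R"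
begin

abbreviation "S \<equiv> carrier R - p"
abbreviation "L \<equiv> loc_at R p"
abbreviation "fr \<equiv> fraction R (carrier R - p)"

definition contraction :: "('a \<times> 'a) set set \<Rightarrow> 'a set" where
  "contraction I = {a \<in> carrier R. fr a \<one> \<in> I}"

definition extension :: "'a set \<Rightarrow> ('a \<times> 'a) set set" where
  "extension q = {fr a s | a s. a \<in> q \<and> s \<in> S}"

lemma one_S: "\<one> \<in> S" using primeideal_one[OF prime] by simp

lemma S_mult: "s \<in> S \<Longrightarrow> t \<in> S \<Longrightarrow> s \<otimes> t \<in> S"
  by (rule primeideal_mult_notin[OF prime])

lemma submonoid_S: "submonoid S R"
proof (rule submonoid.intro)
  show "S \<subseteq> carrier R" by blast
qed (use one_S S_mult in simp_all)

lemma cring_L: "cring L" unfolding loc_at_def by (rule cring_localization[OF submonoid_S])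

lemma ring_L: "ring L" using cring_L by (rule cring.axioms(1))

lemma fr_carrier: "a \<in> carrier R \<Longrightarrow> s \<in> S \<Longrightarrow> fr a s \<in> carrier L"
  unfolding loc_at_def by (rule fraction_in_carrier[OF submonoid_S])

lemma fr_cases:
  assumes "x \<in> carrier L" obtains a s where "a \<in> carrier R" "s \<in> S" "x = fr a s"
  using assms unfolding loc_at_def loc_carrier[OF submonoid_S] by blast

lemma fr_mult: "a \<in> carrier R \<Longrightarrow> b \<in> carrier R \<Longrightarrow> s \<in> S \<Longrightarrow> t \<in> S \<Longrightarrow> fr a s \<otimes>\<^bsub>L\<^esub> fr b t = fr (a \<otimes> b) (s \<otimes> t)"
  unfolding loc_at_def by (rule fraction_mult[OF submonoid_S])

lemma fr_add: "a \<in> carrier R \<Longrightarrow> b \<in> carrier R \<Longrightarrow> s \<in> S \<Longrightarrow> t \<in> S \<Longrightarrow>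
    fr a s \<oplus>\<^bsub>L\<^esub> fr b t = fr (t \<otimes> a \<oplus> s \<otimes> b) (s \<otimes> t)"
  unfolding loc_at_def by (rule fraction_add[OF submonoid_S])

lemma L_one: "\<one>\<^bsub>L\<^esub> = fr \<one> \<one>" and L_zero: "\<zero>\<^bsub>L\<^esub> = fr \<zero> \<one>"
  unfolding loc_at_def by (rule loc_one[OF submonoid_S] loc_zero[OF submonoid_S])+

lemmas fr_eq_iff = fraction_eq_iff[OF submonoid_S]

lemma fr_zero_iff:
  assumes "a \<in> carrier R" "s \<in> S"
  shows "fr a s = \<zero>\<^bsub>L\<^esub> \<longleftrightarrow> (\<exists>u\<in>S. u \<otimes> a = \<zero>)"
  unfolding L_zero using assms one_S by (subst fr_eq_iff) (auto simp: a_minus_def)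

lemma fr_cancel:
  assumes "a \<in> carrier R" "s \<in> S" "u \<in> S" shows "fr (u \<otimes> a) (u \<otimes> s) = fr a s"
proof -
  have "s \<otimes> (u \<otimes> a) = (u \<otimes> s) \<otimes> a" using assms by (simp add: m_ac)
  then show ?thesis
    using assms S_mult by (intro fraction_eqI[OF submonoid_S]) auto
qed

lemma fr_in_ideal_iff:
  assumes I: "ideal I L" and a: "a \<in> carrier R" and s: "s \<in> S"
  shows "fr a s \<in> I \<longleftrightarrow> a \<in> contraction I"
proof -
  have sc: "s \<in> carrier R" using s by simp
  have "fr s \<one> \<otimes>\<^bsub>L\<^esub> fr a s = fr (s \<otimes> a) (s \<otimes> \<one>)"
    using fr_mult[OF sc a one_S s] sc by simp
  also have "\<dots> = fr a \<one>" by (rule fr_cancel[OF a one_S s])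
  finally have 1: "fr s \<one> \<otimes>\<^bsub>L\<^esub> fr a s = fr a \<one>" .
  have 2: "fr \<one> s \<otimes>\<^bsub>L\<^esub> fr a \<one> = fr a s"
    using fr_mult[OF one_closed a s one_S] sc a by simp
  show ?thesis
    using ideal.I_l_closed[OF I, of "fr a s" "fr s \<one>"] ideal.I_l_closed[OF I, of "fr a \<one>" "fr \<one> s"]
      fr_carrier[OF sc one_S] fr_carrier[OF one_closed s] a
    unfolding contraction_def 1 2 by auto
qed

lemma contraction_subset_iff:
  assumes "ideal I L" "ideal K L"
  shows "contraction I \<subseteq> contraction K \<longleftrightarrow> I \<subseteq> K"
proof
  assume sub: "contraction I \<subseteq> contraction K"
  show "I \<subseteq> K"
  proof
    fix x assume x: "x \<in> I"
    obtain a s where a: "a \<in> carrier R" "s \<in> S" "x = fr a s"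
      using fr_cases[OF ideal.Icarr[OF assms(1) x]] by blast
    then show "x \<in> K"
      using x sub fr_in_ideal_iff[OF assms(1) a(1,2)] fr_in_ideal_iff[OF assms(2) a(1,2)] by auto
  qed
qed (auto simp: contraction_def)

lemma contraction_ideal:
  assumes I: "ideal I L" shows "ideal (contraction I) R"
proof (rule idealI_closed)
  interpret L: cring L by (rule cring_L)
  show "contraction I \<subseteq> carrier R" by (auto simp: contraction_def)
  show "\<zero> \<in> contraction I" using L.ideal_zero[OF I] by (simp add: contraction_def L_zero)
  fix a assume "a \<in> contraction I"
  then have a: "a \<in> carrier R" "fr a \<one> \<in> I" by (auto simp: contraction_def)
  {
    fix b assume "b \<in> contraction I"
    then have b: "b \<in> carrier R" "fr b \<one> \<in> I" by (auto simp: contraction_def)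
    have "fr a \<one> \<oplus>\<^bsub>L\<^esub> fr b \<one> = fr (a \<oplus> b) \<one>" using fr_add[OF a(1) b(1) one_S one_S] a b by simp
    then show "a \<oplus> b \<in> contraction I" using L.ideal_add[OF I a(2) b(2)] a b by (simp add: contraction_def)
  next
    fix r assume r: "r \<in> carrier R"
    have "fr r \<one> \<otimes>\<^bsub>L\<^esub> fr a \<one> = fr (r \<otimes> a) \<one>" using fr_mult[OF r a(1) one_S one_S] by simp
    then show "r \<otimes> a \<in> contraction I"
      using L.ideal_mult[OF I a(2) fr_carrier[OF r one_S]] a r by (simp add: contraction_def)
  }
qed

lemma contraction_subset_prime:
  assumes I: "ideal I L" and "I \<noteq> carrier L"
  shows "contraction I \<subseteq> p"
proof (rule ccontr)
  interpret L: cring L by (rule cring_L)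
  assume "\<not> ?thesis"
  then obtain s where s: "s \<in> contraction I" "s \<in> S" by (auto simp: contraction_def)
  have "fr s s \<in> I" using fr_in_ideal_iff[OF I _ s(2)] s by auto
  moreover have "fr s s = \<one>\<^bsub>L\<^esub>" using fr_cancel[OF one_closed one_S s(2)] s(2) by (simp add: L_one)
  ultimately show False using ideal.one_imp_carrier[OF I] assms(2) by simp
qed

lemma contraction_prime:
  assumes "primeideal I L" shows "primeideal (contraction I) R" "contraction I \<subseteq> p"
proof -
  have I: "ideal I L" using assms by (rule primeideal.axioms(1))
  have "I \<noteq> carrier L" using primeideal.I_notcarr[OF assms] by blast
  then show sub: "contraction I \<subseteq> p" by (rule contraction_subset_prime[OF I])
  show "primeideal (contraction I) R"
  proof (rule primeidealI[OF contraction_ideal[OF I] is_cring])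
    show "carrier R \<noteq> contraction I" using sub one_S by blast
    fix a b assume ab: "a \<in> carrier R" "b \<in> carrier R" "a \<otimes> b \<in> contraction I"
    have "fr a \<one> \<otimes>\<^bsub>L\<^esub> fr b \<one> \<in> I" using fr_mult[OF ab(1,2) one_S one_S] ab(3) by (simp add: contraction_def)
    then have "fr a \<one> \<in> I \<or> fr b \<one> \<in> I" 
      using primeideal.I_prime[OF assms fr_carrier[OF ab(1) one_S] fr_carrier[OF ab(2) one_S]] by blast
    then show "a \<in> contraction I \<or> b \<in> contraction I" using ab by (auto simp: contraction_def)
  qed
qed

lemma fr_in_extension_iff:
  assumes q: "primeideal q R" "q \<subseteq> p" and a: "a \<in> carrier R" "s \<in> S"
  shows "fr a s \<in> extension q \<longleftrightarrow> a \<in> q"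
proof
  assume "fr a s \<in> extension q"
  then obtain b t where b: "b \<in> q" "t \<in> S" "fr a s = fr b t" by (auto simp: extension_def)
  have iq: "ideal q R" using primeideal_ideal[OF q(1)] .
  have bc: "b \<in> carrier R" using ideal_carr[OF iq b(1)] .
  obtain u where u: "u \<in> S" "u \<otimes> (t \<otimes> a \<ominus> s \<otimes> b) = \<zero>" using b(3) fr_eq_iff[OF a(1) bc a(2) b(2)] by blast
  have c: "u \<in> carrier R" "t \<in> carrier R" "s \<in> carrier R" using u b a by auto
  have "(u \<otimes> t) \<otimes> a = u \<otimes> (t \<otimes> a \<ominus> s \<otimes> b) \<oplus> (u \<otimes> s) \<otimes> b" using c bc a(1) by algebra
  then have "(u \<otimes> t) \<otimes> a = (u \<otimes> s) \<otimes> b" unfolding u(2) using c bc by simp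
  then have "(u \<otimes> t) \<otimes> a \<in> q" using ideal_mult[OF iq b(1)] c by simp
  moreover have "u \<otimes> t \<notin> q" using S_mult[OF u(1) b(2)] q(2) by blast
  ultimately show "a \<in> q" using primeideal.I_prime[OF q(1), of "u \<otimes> t" a] c a by auto
qed (use a in \<open>auto simp: extension_def\<close>)

lemma extension_prime:
  assumes q: "primeideal q R" "q \<subseteq> p" shows "primeideal (extension q) L"
proof (rule primeidealI)
  interpret L: cring L by (rule cring_L)
  note iff = fr_in_extension_iff[OF q]
  have iq: "ideal q R" using primeideal_ideal[OF q(1)] .
  show "cring L" by (rule cring_L)
  have sub: "extension q \<subseteq> carrier L" using fr_carrier ideal_carr[OF iq] by (auto simp: extension_def)
  show "carrier L \<noteq> extension q"
  proof
    assume "carrier L = extension q"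
    then have "fr \<one> \<one> \<in> extension q" using fr_carrier[OF one_closed one_S] by simp
    then show False using iff[OF one_closed one_S] one_S q(2) by blast
  qed
  show "ideal (extension q) L"
  proof (rule L.idealI_closed[OF sub])
    show "\<zero>\<^bsub>L\<^esub> \<in> extension q" using ideal_zero[OF iq] one_S by (auto simp: extension_def L_zero)
    fix x assume "x \<in> extension q"
    then obtain a s where a: "a \<in> q" "s \<in> S" "x = fr a s" by (auto simp: extension_def)
    {
      fix y assume "y \<in> extension q"
      then obtain b t where b: "b \<in> q" "t \<in> S" "y = fr b t" by (auto simp: extension_def)
      have "x \<oplus>\<^bsub>L\<^esub> y = fr (t \<otimes> a \<oplus> s \<otimes> b) (s \<otimes> t)"
        using fr_add[of a b s t] a b ideal_carr[OF iq] by simp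
      moreover have "t \<otimes> a \<oplus> s \<otimes> b \<in> q"
        using ideal_add[OF iq ideal_mult[OF iq a(1)] ideal_mult[OF iq b(1)]] a b by simp
      ultimately show "x \<oplus>\<^bsub>L\<^esub> y \<in> extension q" 
        using S_mult[OF a(2) b(2)] unfolding extension_def by blast
    next
      fix y assume "y \<in> carrier L"
      then obtain b t where b: "b \<in> carrier R" "t \<in> S" "y = fr b t" using fr_cases by blast
      have "y \<otimes>\<^bsub>L\<^esub> x = fr (b \<otimes> a) (t \<otimes> s)" using fr_mult[of b a t s] a b ideal_carr[OF iq a(1)] by simp
      then show "y \<otimes>\<^bsub>L\<^esub> x \<in> extension q"
        using ideal_mult[OF iq a(1) b(1)] S_mult[OF b(2) a(2)] unfolding extension_def by blast
    }
  qed
  fix x y assume xy: "x \<in> carrier L" "y \<in> carrier L" "x \<otimes>\<^bsub>L\<^esub> y \<in> extension q"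
  obtain a s where a: "a \<in> carrier R" "s \<in> S" "x = fr a s" using fr_cases[OF xy(1)] by blast
  obtain b t where b: "b \<in> carrier R" "t \<in> S" "y = fr b t" using fr_cases[OF xy(2)] by blast
  have "fr (a \<otimes> b) (s \<otimes> t) \<in> extension q" using xy(3) a b fr_mult[of a b s t] by simp
  then have "a \<otimes> b \<in> q" using iff[OF _ S_mult[OF a(2) b(2)]] a b by simp
  then have "a \<in> q \<or> b \<in> q" using primeideal.I_prime[OF q(1) a(1) b(1)] by blast
  then show "x \<in> extension q \<or> y \<in> extension q" using iff a b by simp
qed

lemma contraction_extension:
  assumes "primeideal q R" "q \<subseteq> p" shows "contraction (extension q) = q"
  using fr_in_extension_iff[OF assms _ one_S] ideal_carr[OF primeideal_ideal[OF assms(1)]]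
  by (auto simp: contraction_def)

text \<open>Generators of the contraction of an ideal of \<open>L\<close> generate the ideal itself.\<close>

lemma noetherian_L: "noetherian_ring L"
proof (rule ring.noetherian_ringI[OF ring_L])
  interpret L: cring L by (rule cring_L)
  fix I assume I: "ideal I L"
  obtain A where A: "A \<subseteq> carrier R" "finite A" "contraction I = Idl A"
    using finetely_gen[OF contraction_ideal[OF I]] by blast
  let ?A = "(\<lambda>a. fr a \<one>) ` A"
  have Ac: "?A \<subseteq> carrier L" using A(1) fr_carrier one_S by blast
  have K: "ideal (Idl\<^bsub>L\<^esub> ?A) L" by (rule L.genideal_ideal[OF Ac])
  have "?A \<subseteq> I" using genideal_self[OF A(1)] A(3) by (auto simp: contraction_def)
  then have 1: "Idl\<^bsub>L\<^esub> ?A \<subseteq> I" by (rule L.genideal_minimal[OF I])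
  have "A \<subseteq> contraction (Idl\<^bsub>L\<^esub> ?A)"
    using L.genideal_self[OF Ac] A(1) by (auto simp: contraction_def)
  then have "contraction I \<subseteq> contraction (Idl\<^bsub>L\<^esub> ?A)"
    unfolding A(3) by (rule genideal_minimal[OF contraction_ideal[OF K]])
  then have "I \<subseteq> Idl\<^bsub>L\<^esub> ?A" using contraction_subset_iff[OF I K] by blast
  then show "\<exists>A\<subseteq>carrier L. finite A \<and> I = Idl\<^bsub>L\<^esub> A" using 1 A(2) Ac by blast
qed

lemma height_L:
  assumes "primeideal I L" shows "height L I = height R (contraction I)"
proof (rule enat_eqI)
  fix n show "enat n \<le> height L I \<longleftrightarrow> enat n \<le> height R (contraction I)"
    using assms
  proof (induction n arbitrary: I)
    case 0
    then show ?case by (simp add: zero_enat_def[symmetric])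
  next
    case (Suc n)
    have I: "ideal I L" using Suc.prems by (rule primeideal.axioms(1))
    show ?case
    proof
      assume "enat (Suc n) \<le> height L I"
      then obtain K where K: "primeideal K L" "K \<subset> I" "enat n \<le> height L K"
        unfolding height_Suc_iff by (auto simp: Spec_def)
      have iK: "ideal K L" using K(1) by (rule primeideal.axioms(1))
      have "contraction K \<subset> contraction I"
        using contraction_subset_iff[OF I iK] contraction_subset_iff[OF iK I] K(2) by blast
      moreover have "enat n \<le> height R (contraction K)" using Suc.IH[OF K(1)] K(3) by blast
      ultimately show "enat (Suc n) \<le> height R (contraction I)"
        using contraction_prime(1)[OF K(1)] by (intro height_mono_strict[of "contraction K"]) (simp_all add: Spec_def)
    next
      assume "enat (Suc n) \<le> height R (contraction I)"
      then obtain q where q: "primeideal q R" "q \<subset> contraction I" "enat n \<le> height R q"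
        unfolding height_Suc_iff by (auto simp: Spec_def)
      have qp: "q \<subseteq> p" using q(2) contraction_prime(2)[OF Suc.prems] by blast
      note E = extension_prime[OF q(1) qp] and CE = contraction_extension[OF q(1) qp]
      have iE: "ideal (extension q) L" using E by (rule primeideal.axioms(1))
      have "extension q \<subset> I"
        using contraction_subset_iff[OF I iE] contraction_subset_iff[OF iE I] q(2) unfolding CE by blast
      moreover have "enat n \<le> height L (extension q)" using Suc.IH[OF E] q(3) unfolding CE by blast
      ultimately show "enat (Suc n) \<le> height L I"
        using E by (intro height_mono_strict[of "extension q"]) (simp_all add: Spec_def)
    qed
  qed
qed

lemmas extension_self_prime = extension_prime[OF prime order_refl]

lemma proper_ideal_L_subset:
  assumes "ideal I L" "I \<noteq> carrier L" shows "I \<subseteq> extension p"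
  using contraction_subset_prime[OF assms] contraction_extension[OF prime order_refl]
    contraction_subset_iff[OF assms(1) primeideal.axioms(1)[OF extension_self_prime]] by simp

lemma maximal_ideals_L: "{m. maximalideal m L} = {extension p}"
proof -
  have iE: "ideal (extension p) L" using extension_self_prime by (rule primeideal.axioms(1))
  have ne: "extension p \<noteq> carrier L" using primeideal.I_notcarr[OF extension_self_prime] by blast
  have "maximalideal (extension p) L"
  proof (rule maximalidealI[OF iE])
    fix J assume "ideal J L" "extension p \<subseteq> J"
    then show "J = extension p \<or> J = carrier L" using proper_ideal_L_subset by blast
  qed (use ne in simp)
  moreover have "m = extension p" if "maximalideal m L" for m
  proof -
    have "ideal m L" "m \<noteq> carrier L"
      using that maximalideal.axioms(1) maximalideal.I_notcarr[OF that] by blast+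
    then have "m \<subseteq> extension p" by (rule proper_ideal_L_subset)
    then show ?thesis
      using maximalideal.I_maximal[OF that iE] ideal.Icarr[OF iE] ne by blast
  qed
  ultimately show ?thesis by blast
qed

lemma krull_dim_L: "krull_dim L = height R p"
proof -
  have E: "extension p \<in> Spec L" using extension_self_prime by (simp add: Spec_def)
  have "krull_dim L = height L (extension p)"
  proof (rule antisym)
    show "krull_dim L \<le> height L (extension p)"
      unfolding krull_dim_def
    proof (rule SUP_least)
      fix I assume I: "I \<in> Spec L"
      then have "ideal I L" "I \<noteq> carrier L"
        using primeideal.axioms(1) primeideal.I_notcarr by (auto simp: Spec_def)
      then show "height L I \<le> height L (extension p)"
        using height_mono[OF I] proper_ideal_L_subset by blast
    qed
  qed (rule height_le_krull_dim[OF E])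
  then show ?thesis using height_L[OF extension_self_prime] contraction_extension[OF prime order_refl] by simp
qed

lemma loc_ideal_eq: "loc_ideal R p = extension p"
proof -
  interpret L: cring L by (rule cring_L)
  have iE: "ideal (extension p) L" using extension_self_prime by (rule primeideal.axioms(1))
  have pc: "a \<in> carrier R" if "a \<in> p" for a using that ideal_carr[OF primeideal_ideal[OF prime]] by blast
  let ?A = "loc_map R S ` p"
  have A: "?A \<subseteq> extension p" using one_S by (auto simp: extension_def loc_map_def)
  have Ac: "?A \<subseteq> carrier L" using fr_carrier[OF pc one_S] by (auto simp: loc_map_def)
  have iI: "ideal (Idl\<^bsub>L\<^esub> ?A) L" by (rule L.genideal_ideal[OF Ac])
  have "p \<subseteq> contraction (Idl\<^bsub>L\<^esub> ?A)"
    using L.genideal_self[OF Ac] pc by (auto simp: contraction_def loc_map_def)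
  then have "extension p \<subseteq> Idl\<^bsub>L\<^esub> ?A"
    using contraction_subset_iff[OF iE iI] contraction_extension[OF prime order_refl] by simp
  then show ?thesis unfolding loc_ideal_def using L.genideal_minimal[OF iE A] by blast
qed

lemma CM_iff: "p \<in> CM R \<longleftrightarrow> grade L (loc_ideal R p) = height R p"
  using prime cring_L noetherian_L
  by (simp add: CM_def Spec_def cohen_macaulay_local_def maximal_ideals_L krull_dim_L loc_ideal_eq)

text \<open>If \<open>R\<^sub>p\<close> has depth at most 1, then no \<open>y \<in> p\<close> extends \<open>s\<close> to a regular sequence of \<open>R\<^sub>p\<close>, that is, every \<open>y \<in> p\<close> is a zero divisor
  on \<open>R\<^sub>p/sR\<^sub>p\<close>. Clearing denominators turns this into the elementwise criterion for \<open>p\<close> to be associated to \<open>R/sR\<close>.\<close>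

lemma assoc_prime_if_local_grade_le_1:
  assumes s: "s \<in> nonzerodivisors R" "s \<in> p" and grade: "\<not> enat 2 \<le> grade L (loc_ideal R p)"
  shows "p \<in> assoc_primes (PIdl s)"
proof -
  interpret L: cring L by (rule cring_L)
  have sc: "s \<in> carrier R" using s(1) by (simp add: nonzerodivisors_def)
  have iE: "ideal (extension p) L" using extension_self_prime by (rule primeideal.axioms(1))
  have ne: "extension p \<noteq> carrier L" using primeideal.I_notcarr[OF extension_self_prime] by blast
  show ?thesis
  proof (rule assoc_primesI_elementwise[OF cgenideal_ideal[OF sc] prime], rule ccontr)
    fix y assume y: "y \<in> p" and no: "\<not> (\<exists>b\<in>carrier R. y \<otimes> b \<in> PIdl s \<and> colon (PIdl s) b \<subseteq> p)"
    have yc: "y \<in> carrier R" using ideal_carr[OF primeideal_ideal[OF prime] y] .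
    let ?s = "fr s \<one>" and ?y = "fr y \<one>"
    have c: "?s \<in> carrier L" "?y \<in> carrier L" using fr_carrier one_S sc yc by auto
    have E: "{?s, ?y} \<subseteq> extension p" using s(2) y one_S by (auto simp: extension_def)
    have "Idl\<^bsub>L\<^esub> {?s, ?y} \<noteq> carrier L"
      using L.genideal_minimal[OF iE E] ne ideal.Icarr[OF iE] by blast
    moreover have "?s \<in> nonzerodivisors L"
      unfolding nonzerodivisors_def
    proof (intro CollectI conjI ballI impI c(1))
      fix x assume x: "x \<in> carrier L" "?s \<otimes>\<^bsub>L\<^esub> x = \<zero>\<^bsub>L\<^esub>"
      obtain b t where b: "b \<in> carrier R" "t \<in> S" "x = fr b t" using fr_cases[OF x(1)] by blast
      have "fr (s \<otimes> b) t = \<zero>\<^bsub>L\<^esub>" using x(2) b fr_mult[OF sc b(1) one_S b(2)] by simp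
      then obtain u where u: "u \<in> S" "u \<otimes> (s \<otimes> b) = \<zero>" using fr_zero_iff[of "s \<otimes> b" t] b sc by auto
      have "s \<otimes> (u \<otimes> b) = \<zero>" using u sc b(1) by (simp add: m_lcomm)
      then have "u \<otimes> b = \<zero>" using s(1) u(1) b(1) by (auto simp: nonzerodivisors_def)
      then show "x = \<zero>\<^bsub>L\<^esub>" using fr_zero_iff b u(1) by auto
    qed
    moreover have "x \<in> PIdl\<^bsub>L\<^esub> ?s" if x: "x \<in> carrier L" "?y \<otimes>\<^bsub>L\<^esub> x \<in> PIdl\<^bsub>L\<^esub> ?s" for x
    proof -
      obtain b t where b: "b \<in> carrier R" "t \<in> S" "x = fr b t" using fr_cases[OF x(1)] by blast
      obtain z where z: "z \<in> carrier L" "?y \<otimes>\<^bsub>L\<^esub> x = z \<otimes>\<^bsub>L\<^esub> ?s" using x(2) L.PIdl_iff by blast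
      obtain d v where d: "d \<in> carrier R" "v \<in> S" "z = fr d v" using fr_cases[OF z(1)] by blast
      have tv: "t \<in> carrier R" "v \<in> carrier R" using b d by auto
      have "fr (y \<otimes> b) t = fr (d \<otimes> s) v"
        using z(2) b d fr_mult[OF yc b(1) one_S b(2)] fr_mult[OF d(1) sc d(2) one_S] by simp
      then obtain u where u: "u \<in> S" "u \<otimes> (v \<otimes> (y \<otimes> b) \<ominus> t \<otimes> (d \<otimes> s)) = \<zero>"
        using fr_eq_iff[of "y \<otimes> b" "d \<otimes> s" t v] b d yc sc by auto
      have uc: "u \<in> carrier R" using u by simp
      have "y \<otimes> (u \<otimes> v \<otimes> b) = u \<otimes> (v \<otimes> (y \<otimes> b) \<ominus> t \<otimes> (d \<otimes> s)) \<oplus> (u \<otimes> t \<otimes> d) \<otimes> s"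
        using uc tv yc b(1) d(1) sc by algebra
      then have "y \<otimes> (u \<otimes> v \<otimes> b) = (u \<otimes> t \<otimes> d) \<otimes> s" unfolding u(2) using uc tv d(1) sc by simp
      then have "y \<otimes> (u \<otimes> v \<otimes> b) \<in> PIdl s" using uc tv d(1) PIdl_iff by auto
      then have "\<not> colon (PIdl s) (u \<otimes> v \<otimes> b) \<subseteq> p" using no uc tv b(1) by blast
      then obtain w e where w: "w \<in> S" "e \<in> carrier R" "w \<otimes> (u \<otimes> v \<otimes> b) = e \<otimes> s"
        by (auto simp: colon_def PIdl_iff)
      have wc: "w \<in> carrier R" using w by simp
      have wuv: "w \<otimes> u \<otimes> v \<in> S" using S_mult w(1) u(1) d(2) by blast
      have "x = fr ((w \<otimes> u \<otimes> v) \<otimes> b) ((w \<otimes> u \<otimes> v) \<otimes> t)" using fr_cancel[OF b(1,2) wuv] b(3) by simp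
      also have "(w \<otimes> u \<otimes> v) \<otimes> b = e \<otimes> s" using w(3) wc uc tv b(1) by (simp add: m_assoc)
      also have "fr (e \<otimes> s) ((w \<otimes> u \<otimes> v) \<otimes> t) = fr e ((w \<otimes> u \<otimes> v) \<otimes> t) \<otimes>\<^bsub>L\<^esub> ?s"
        using fr_mult[OF w(2) sc S_mult[OF wuv b(2)] one_S] wc uc tv by simp
      finally show ?thesis using L.PIdl_iff fr_carrier[OF w(2) S_mult[OF wuv b(2)]] by blast
    qed
    ultimately have "regular_sequence L [?s, ?y]" using L.regular_sequence_pair c(2) by blast
    then have "enat 2 \<le> grade L (extension p)"
      using E by (subst L.grade_ge_iff) (auto intro!: exI[of _ "[?s, ?y]"])
    then show False using grade loc_ideal_eq by simp
  qed
qed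

end

section \<open>The total quotient ring and the normalization modulo the base\<close>

context cring
begin

lemma nonzerodivisors_cancel:
  "x \<in> nonzerodivisors R \<Longrightarrow> b \<in> carrier R \<Longrightarrow> x \<otimes> b = \<zero> \<Longrightarrow> b = \<zero>"
  by (simp add: nonzerodivisors_def)

lemma submonoid_nonzerodivisors: "submonoid (nonzerodivisors R) R"
proof (rule submonoid.intro)
  show "nonzerodivisors R \<subseteq> carrier R" "\<one> \<in> nonzerodivisors R" by (auto simp: nonzerodivisors_def)
  fix x y assume xy: "x \<in> nonzerodivisors R" "y \<in> nonzerodivisors R"
  then have c: "x \<in> carrier R" "y \<in> carrier R" by (simp_all add: nonzerodivisors_def)
  have "b = \<zero>" if "b \<in> carrier R" "x \<otimes> y \<otimes> b = \<zero>" for b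
    using nonzerodivisors_cancel[OF xy(1), of "y \<otimes> b"] nonzerodivisors_cancel[OF xy(2), of b] that c
    by (simp add: m_assoc)
  then show "x \<otimes> y \<in> nonzerodivisors R" using c unfolding nonzerodivisors_def by blast
qed

abbreviation "N \<equiv> nonzerodivisors R"
abbreviation "Q \<equiv> total_quot R"
abbreviation "quo \<equiv> fraction R (nonzerodivisors R)"
abbreviation "\<iota> \<equiv> loc_map R (nonzerodivisors R)"
abbreviation "B \<equiv> base_image R"

lemma N_carrier: "s \<in> N \<Longrightarrow> s \<in> carrier R" by (simp add: nonzerodivisors_def)

lemma one_N: "\<one> \<in> N" using submonoid.one_closed[OF submonoid_nonzerodivisors] .

lemma cring_Q: "cring Q"
  unfolding total_quot_def by (rule cring_localization[OF submonoid_nonzerodivisors])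

lemma quo_carrier: "a \<in> carrier R \<Longrightarrow> s \<in> N \<Longrightarrow> quo a s \<in> carrier Q"
  unfolding total_quot_def by (rule fraction_in_carrier[OF submonoid_nonzerodivisors])

lemma quo_cases:
  assumes "x \<in> carrier Q" obtains a s where "a \<in> carrier R" "s \<in> N" "x = quo a s"
  using assms unfolding total_quot_def loc_carrier[OF submonoid_nonzerodivisors] by blast

lemma quo_mult: "a \<in> carrier R \<Longrightarrow> b \<in> carrier R \<Longrightarrow> s \<in> N \<Longrightarrow> t \<in> N \<Longrightarrow>
    quo a s \<otimes>\<^bsub>Q\<^esub> quo b t = quo (a \<otimes> b) (s \<otimes> t)"
  unfolding total_quot_def by (rule fraction_mult[OF submonoid_nonzerodivisors])

lemma quo_eq_iff:
  assumes "a \<in> carrier R" "b \<in> carrier R" "s \<in> N" "t \<in> N"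
  shows "quo a s = quo b t \<longleftrightarrow> t \<otimes> a = s \<otimes> b"
proof -
  have c: "s \<in> carrier R" "t \<in> carrier R" using assms N_carrier by auto
  have "quo a s = quo b t \<longleftrightarrow> (\<exists>u\<in>N. u \<otimes> (t \<otimes> a \<ominus> s \<otimes> b) = \<zero>)"
    by (rule fraction_eq_iff[OF submonoid_nonzerodivisors assms])
  also have "\<dots> \<longleftrightarrow> t \<otimes> a \<ominus> s \<otimes> b = \<zero>"
  proof
    show "t \<otimes> a \<ominus> s \<otimes> b = \<zero>" if ex: "\<exists>u\<in>N. u \<otimes> (t \<otimes> a \<ominus> s \<otimes> b) = \<zero>"
    proof -
      obtain u where "u \<in> N" "u \<otimes> (t \<otimes> a \<ominus> s \<otimes> b) = \<zero>" using ex by blast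
      then show ?thesis using nonzerodivisors_cancel[of u] assms c by simp
    qed
    show "\<exists>u\<in>N. u \<otimes> (t \<otimes> a \<ominus> s \<otimes> b) = \<zero>" if "t \<otimes> a \<ominus> s \<otimes> b = \<zero>"
      using that one_N by (intro bexI[of _ \<one>]) auto
  qed
  also have "\<dots> \<longleftrightarrow> t \<otimes> a = s \<otimes> b" using assms c by simp
  finally show ?thesis .
qed

lemma iota_carrier: "a \<in> carrier R \<Longrightarrow> \<iota> a \<in> carrier Q"
  unfolding loc_map_def by (rule quo_carrier[OF _ one_N])

lemma iota_mult: "a \<in> carrier R \<Longrightarrow> b \<in> carrier R \<Longrightarrow> \<iota> (a \<otimes> b) = \<iota> a \<otimes>\<^bsub>Q\<^esub> \<iota> b"
  unfolding loc_map_def using quo_mult[OF _ _ one_N one_N, of a b] by simp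

lemma iota_add: "a \<in> carrier R \<Longrightarrow> b \<in> carrier R \<Longrightarrow> \<iota> (a \<oplus> b) = \<iota> a \<oplus>\<^bsub>Q\<^esub> \<iota> b"
  unfolding loc_map_def total_quot_def
  using fraction_add[OF submonoid_nonzerodivisors _ _ one_N one_N, of a b] by simp

lemma iota_one: "\<iota> \<one> = \<one>\<^bsub>Q\<^esub>" and iota_zero: "\<iota> \<zero> = \<zero>\<^bsub>Q\<^esub>"
  unfolding loc_map_def total_quot_def
  by (simp_all add: loc_one[OF submonoid_nonzerodivisors] loc_zero[OF submonoid_nonzerodivisors])

lemma iota_times_quo: "r \<in> carrier R \<Longrightarrow> a \<in> carrier R \<Longrightarrow> s \<in> N \<Longrightarrow> \<iota> r \<otimes>\<^bsub>Q\<^esub> quo a s = quo (r \<otimes> a) s"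
  unfolding loc_map_def using quo_mult[of r a \<one> s] one_N N_carrier by simp

lemma quo_in_base_iff:
  assumes "a \<in> carrier R" "s \<in> N" shows "quo a s \<in> B \<longleftrightarrow> a \<in> PIdl s"
proof -
  have "quo a s \<in> B \<longleftrightarrow> (\<exists>c\<in>carrier R. quo a s = quo c \<one>)"
    by (auto simp: base_image_def loc_map_def)
  also have "\<dots> \<longleftrightarrow> (\<exists>c\<in>carrier R. a = c \<otimes> s)"
    using assms N_carrier[OF assms(2)] one_N by (auto simp: quo_eq_iff m_comm)
  finally show ?thesis by (simp add: PIdl_iff)
qed

lemma abelian_subgroup_B: "abelian_subgroup B Q"
proof -
  interpret Q: cring Q by (rule cring_Q)
  have neg: "\<ominus>\<^bsub>Q\<^esub> \<iota> a = \<iota> (\<ominus> a)" if "a \<in> carrier R" for a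
  proof (rule Q.minus_equality)
    show "\<iota> (\<ominus> a) \<oplus>\<^bsub>Q\<^esub> \<iota> a = \<zero>\<^bsub>Q\<^esub>"
      using iota_add[of "\<ominus> a" a] that by (simp add: l_neg iota_zero)
  qed (use that iota_carrier in auto)
  have "additive_subgroup B Q"
  proof (rule additive_subgroup.intro, rule group.subgroupI)
    show "group (add_monoid Q)" by (rule Q.add.is_group)
    show "B \<subseteq> carrier (add_monoid Q)" by (auto simp: base_image_def iota_carrier)
    show "B \<noteq> {}" by (auto simp: base_image_def)
    fix x assume "x \<in> B"
    then obtain a where a: "a \<in> carrier R" "x = \<iota> a" by (auto simp: base_image_def)
    then have "\<ominus>\<^bsub>Q\<^esub> x \<in> B" using neg by (auto simp: base_image_def)
    then show "inv\<^bsub>add_monoid Q\<^esub> x \<in> B" by (simp add: a_inv_def)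
    fix y assume "y \<in> B"
    then obtain b where b: "b \<in> carrier R" "y = \<iota> b" by (auto simp: base_image_def)
    then have "x \<oplus>\<^bsub>Q\<^esub> y = \<iota> (a \<oplus> b)" using a iota_add by simp
    then show "x \<otimes>\<^bsub>add_monoid Q\<^esub> y \<in> B" using a b by (auto simp: base_image_def)
  qed
  then show ?thesis using Q.abelian_group_axioms by (rule abelian_subgroupI3)
qed

lemma smult_coset:
  assumes r: "r \<in> carrier R" and x: "x \<in> carrier Q"
  shows "(\<Union>y\<in>B +>\<^bsub>Q\<^esub> x. B +>\<^bsub>Q\<^esub> (\<iota> r \<otimes>\<^bsub>Q\<^esub> y)) = B +>\<^bsub>Q\<^esub> (\<iota> r \<otimes>\<^bsub>Q\<^esub> x)"
proof -
  interpret Q: cring Q by (rule cring_Q)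
  interpret B: abelian_subgroup B Q by (rule abelian_subgroup_B)
  have "B +>\<^bsub>Q\<^esub> (\<iota> r \<otimes>\<^bsub>Q\<^esub> y) = B +>\<^bsub>Q\<^esub> (\<iota> r \<otimes>\<^bsub>Q\<^esub> x)" if y: "y \<in> B +>\<^bsub>Q\<^esub> x" for y
  proof -
    obtain b where b: "b \<in> carrier R" "y = \<iota> b \<oplus>\<^bsub>Q\<^esub> x" using y by (auto simp: a_r_coset_def' base_image_def)
    have "\<iota> r \<otimes>\<^bsub>Q\<^esub> y = \<iota> (r \<otimes> b) \<oplus>\<^bsub>Q\<^esub> \<iota> r \<otimes>\<^bsub>Q\<^esub> x"
      unfolding b(2) using iota_carrier r b(1) x by (simp add: Q.r_distr iota_mult)
    then have "\<iota> r \<otimes>\<^bsub>Q\<^esub> y \<in> B +>\<^bsub>Q\<^esub> (\<iota> r \<otimes>\<^bsub>Q\<^esub> x)" using r b(1) by (auto simp: a_r_coset_def' base_image_def)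
    then show ?thesis
      by (rule B.a_repr_independence'[symmetric]) (rule Q.m_closed[OF iota_carrier[OF r] x])
  qed
  then show ?thesis using B.a_rcos_self[OF x] by (intro SUP_eq_const) blast+
qed

text \<open>Over the common denominator \<open>s\<close>, the multiple \<open>r (a/s)\<close> lies in \<open>R\<close> exactly if \<open>r a \<in> sR\<close>, so the annihilator of \<open>a/s + R\<close> is
  \<open>(sR : a)\<close>.\<close>

lemma Ass_normalization_mod_base_iff:
  "p \<in> Ass R (normalization_mod_base R) \<longleftrightarrow> primeideal p R \<and>
    (\<exists>a\<in>carrier R. \<exists>s\<in>N. quo a s \<in> integral_closure Q B \<and> p = colon (PIdl s) a)"
proof -
  interpret Q: cring Q by (rule cring_Q)
  interpret B: abelian_subgroup B Q by (rule abelian_subgroup_B)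
  let ?M = "normalization_module R"
  have M: "carrier ?M = integral_closure Q B" "(\<oplus>\<^bsub>?M\<^esub>) = (\<oplus>\<^bsub>Q\<^esub>)" "(\<odot>\<^bsub>?M\<^esub>) = (\<lambda>r x. \<iota> r \<otimes>\<^bsub>Q\<^esub> x)"
    by (simp_all add: normalization_module_def normalization_def ring.defs module.defs)
  have coset: "B +>\<^bsub>?M\<^esub> x = B +>\<^bsub>Q\<^esub> x" for x by (simp add: a_r_coset_def' M)
  have ic: "x \<in> carrier Q" if "x \<in> integral_closure Q B" for x using that by (simp add: integral_closure_def)
  have carr: "carrier (normalization_mod_base R) = (\<lambda>x. B +>\<^bsub>Q\<^esub> x) ` integral_closure Q B"
    by (auto simp: normalization_mod_base_def quot_module_def A_RCOSETS_def' coset M)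
  have zero: "\<zero>\<^bsub>normalization_mod_base R\<^esub> = B"
    by (simp add: normalization_mod_base_def quot_module_def)
  have smult: "r \<odot>\<^bsub>normalization_mod_base R\<^esub> (B +>\<^bsub>Q\<^esub> x) = B +>\<^bsub>Q\<^esub> (\<iota> r \<otimes>\<^bsub>Q\<^esub> x)"
    if "r \<in> carrier R" "x \<in> carrier Q" for r x
    using smult_coset[OF that] by (simp add: normalization_mod_base_def quot_module_def coset M)
  have triv: "B +>\<^bsub>Q\<^esub> z = B \<longleftrightarrow> z \<in> B" if "z \<in> carrier Q" for z
    using B.a_rcos_self[OF that] B.a_rcos_const[of z] by auto
  have ann: "{r \<in> carrier R. r \<odot>\<^bsub>normalization_mod_base R\<^esub> (B +>\<^bsub>Q\<^esub> quo a s) = B} = colon (PIdl s) a"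
    if a: "a \<in> carrier R" "s \<in> N" for a s
  proof -
    have "r \<odot>\<^bsub>normalization_mod_base R\<^esub> (B +>\<^bsub>Q\<^esub> quo a s) = B \<longleftrightarrow> r \<otimes> a \<in> PIdl s" if r: "r \<in> carrier R" for r
      using smult[OF r quo_carrier[OF a]] triv[of "\<iota> r \<otimes>\<^bsub>Q\<^esub> quo a s"] iota_times_quo[OF r a]
        quo_in_base_iff[of "r \<otimes> a" s] quo_carrier[of "r \<otimes> a" s] a r by simp
    then show ?thesis by (auto simp: colon_def)
  qed
  show ?thesis
  proof
    assume "p \<in> Ass R (normalization_mod_base R)"
    then obtain x where x: "primeideal p R" "x \<in> integral_closure Q B"
      "p = {r \<in> carrier R. r \<odot>\<^bsub>normalization_mod_base R\<^esub> (B +>\<^bsub>Q\<^esub> x) = B}"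
      by (auto simp: Ass_def Spec_def carr zero)
    obtain a s where a: "a \<in> carrier R" "s \<in> N" "x = quo a s" using quo_cases[OF ic[OF x(2)]] by blast
    then show "primeideal p R \<and> (\<exists>a\<in>carrier R. \<exists>s\<in>N. quo a s \<in> integral_closure Q B \<and> p = colon (PIdl s) a)"
      using x ann[OF a(1,2)] by auto
  next
    assume "primeideal p R \<and> (\<exists>a\<in>carrier R. \<exists>s\<in>N. quo a s \<in> integral_closure Q B \<and> p = colon (PIdl s) a)"
    then obtain a s where a: "primeideal p R" "a \<in> carrier R" "s \<in> N" "quo a s \<in> integral_closure Q B"
      "p = colon (PIdl s) a" by blast
    then show "p \<in> Ass R (normalization_mod_base R)"
      using ann[OF a(2,3)] unfolding Ass_def Spec_def carr zero by auto
  qed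
qed

end

context noetherian_cring
begin

lemma noetherian_chain_stabilizes:
  assumes "\<And>n::nat. ideal (I n) R" "\<And>n. I n \<subseteq> I (Suc n)"
  shows "\<exists>n. I (Suc n) = I n"
proof -
  obtain M where "\<exists>n. M = I n" and max: "\<And>K. \<exists>n. K = I n \<Longrightarrow> M \<subseteq> K \<Longrightarrow> K = M"
    by (rule noetherian_maximal[of "\<lambda>K. \<exists>n. K = I n" "I 0"]) (use assms(1) in auto)
  then obtain n where "M = I n" by blast
  then show ?thesis using max[of "I (Suc n)"] assms(2)[of n] by blast
qed

text \<open>The hypothesis says that \<open>x = a/s\<close> maps \<open>p\<close> into itself, so \<open>b n = s x\<^sup>n\<close> lies in \<open>R\<close> for all \<open>n\<close>. By the ascending chain condition some
  \<open>s x\<^sup>n\<close> is an \<open>R\<close>-linear combination of \<open>s, s x, \<dots>, s x\<^bsup>n-1\<^esup>\<close>; cancelling \<open>s\<close> gives a monic equation for \<open>x\<close>.\<close>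

lemma integral_if_stabilizes_ideal:
  assumes p: "ideal p R" and s: "s \<in> N" "s \<in> p" and a: "a \<in> carrier R"
    and stable: "\<And>c. c \<in> p \<Longrightarrow> \<exists>d\<in>p. c \<otimes> a = d \<otimes> s"
  shows "quo a s \<in> integral_closure Q B"
proof -
  interpret Q: cring Q by (rule cring_Q)
  have sc: "s \<in> carrier R" using N_carrier s(1) .
  let ?x = "quo a s"
  have x: "?x \<in> carrier Q" by (rule quo_carrier[OF a s(1)])
  obtain f where f: "\<And>c. c \<in> p \<Longrightarrow> f c \<in> p \<and> c \<otimes> a = f c \<otimes> s" using stable by metis
  define b where "b n = (f ^^ n) s" for n :: nat
  have bp: "b n \<in> p" for n by (induction n) (use s f in \<open>auto simp: b_def\<close>)
  have bc: "b n \<in> carrier R" for n using ideal_carr[OF p bp] .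
  have b: "\<iota> (b n) = \<iota> s \<otimes>\<^bsub>Q\<^esub> ?x [^]\<^bsub>Q\<^esub> n" for n
  proof (induction n)
    case 0
    then show ?case using iota_carrier[OF sc] by (simp add: b_def)
  next
    case (Suc n)
    have "b n \<otimes> a = b (Suc n) \<otimes> s" using f[OF bp[of n]] by (simp add: b_def)
    then have "\<iota> (b (Suc n)) = quo (b n \<otimes> a) s"
      unfolding loc_map_def using bc a s one_N sc by (subst quo_eq_iff) (auto simp: m_comm)
    also have "\<dots> = \<iota> (b n) \<otimes>\<^bsub>Q\<^esub> ?x" using iota_times_quo[OF bc a s(1)] by simp
    finally show ?case using Suc iota_carrier[OF sc] x by (simp add: Q.m_assoc)
  qed
  define I where "I = rec_nat {\<zero>} (\<lambda>n J. adjoin J (b n))"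
  have I0: "I 0 = {\<zero>}" and ISuc: "I (Suc n) = adjoin (I n) (b n)" for n by (simp_all add: I_def)
  have iI: "ideal (I n) R" for n
    by (induction n) (simp_all add: I0 ISuc zeroideal adjoin_ideal bc)
  \<comment> \<open>\<open>I n\<close> is spanned by \<open>b 0, \<dots>, b (n - 1)\<close>; coefficient lists of length exactly \<open>n\<close> make a coefficient put in front belong to degree \<open>n\<close>.\<close>
  have poly: "\<exists>cs. length cs = n \<and> set cs \<subseteq> B \<and> \<iota> z = \<iota> s \<otimes>\<^bsub>Q\<^esub> Q.eval cs ?x" if "z \<in> I n" for z n
    using that
  proof (induction n arbitrary: z)
    case 0
    then show ?case using iota_carrier[OF sc] by (simp add: I0 iota_zero)
  next
    case (Suc n)
    obtain i r where i: "i \<in> I n" "r \<in> carrier R" "z = i \<oplus> r \<otimes> b n"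
      using Suc.prems adjoin_iff[OF bc] by (auto simp: ISuc)
    obtain cs where cs: "length cs = n" "set cs \<subseteq> B" "\<iota> i = \<iota> s \<otimes>\<^bsub>Q\<^esub> Q.eval cs ?x"
      using Suc.IH[OF i(1)] by blast
    have e: "Q.eval cs ?x \<in> carrier Q"
      using cs(2) iota_carrier by (intro Q.eval_in_carrier[OF _ x]) (auto simp: base_image_def)
    have "\<iota> z = \<iota> i \<oplus>\<^bsub>Q\<^esub> \<iota> r \<otimes>\<^bsub>Q\<^esub> \<iota> (b n)"
      unfolding i(3) using ideal_carr[OF iI i(1)] i(2) bc by (simp add: iota_add iota_mult)
    also have "\<dots> = \<iota> s \<otimes>\<^bsub>Q\<^esub> (\<iota> r \<otimes>\<^bsub>Q\<^esub> ?x [^]\<^bsub>Q\<^esub> n \<oplus>\<^bsub>Q\<^esub> Q.eval cs ?x)"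
      unfolding cs(3) b using e iota_carrier[OF sc] iota_carrier[OF i(2)] Q.nat_pow_closed[OF x, of n]
      by (simp add: Q.r_distr Q.m_lcomm Q.a_comm)
    finally have "\<iota> z = \<iota> s \<otimes>\<^bsub>Q\<^esub> Q.eval (\<iota> r # cs) ?x" using cs(1) by simp
    moreover have "set (\<iota> r # cs) \<subseteq> B" using cs(2) i(2) by (auto simp: base_image_def)
    ultimately show ?case using cs(1) by (intro exI[of _ "\<iota> r # cs"]) simp
  qed
  obtain n where n: "I (Suc n) = I n"
    using noetherian_chain_stabilizes[of I, OF iI] adjoin_subset[OF iI bc] by (auto simp: ISuc)
  then have "b n \<in> I n" using adjoin_self[OF iI bc] by (auto simp: ISuc)
  \<comment> \<open>The combination is taken for \<open>- b n\<close>, so that the monic equation arises by adding \<open>s x\<^sup>n\<close>.\<close>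
  then have "\<zero> \<ominus> b n \<in> I n" using ideal_minus[OF iI ideal_zero[OF iI]] by blast
  then have "\<ominus> b n \<in> I n" using bc by (simp add: a_minus_def)
  then obtain cs where cs: "length cs = n" "set cs \<subseteq> B" "\<iota> (\<ominus> b n) = \<iota> s \<otimes>\<^bsub>Q\<^esub> Q.eval cs ?x"
    using poly by blast
  have e: "Q.eval cs ?x \<in> carrier Q"
    using cs(2) iota_carrier by (intro Q.eval_in_carrier[OF _ x]) (auto simp: base_image_def)
  let ?y = "?x [^]\<^bsub>Q\<^esub> n \<oplus>\<^bsub>Q\<^esub> Q.eval cs ?x"
  have y: "?y \<in> carrier Q" using e x by simp
  have "\<iota> s \<otimes>\<^bsub>Q\<^esub> ?y = \<iota> (b n) \<oplus>\<^bsub>Q\<^esub> \<iota> (\<ominus> b n)"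
    unfolding cs(3) b using e x iota_carrier[OF sc] by (simp add: Q.r_distr)
  also have "\<dots> = \<zero>\<^bsub>Q\<^esub>" using iota_add[of "b n" "\<ominus> b n"] bc by (simp add: r_neg iota_zero)
  finally have 0: "\<iota> s \<otimes>\<^bsub>Q\<^esub> ?y = \<zero>\<^bsub>Q\<^esub>" .
  have inv: "\<iota> s \<otimes>\<^bsub>Q\<^esub> quo \<one> s = \<one>\<^bsub>Q\<^esub>"
  proof -
    have "quo s s = \<iota> \<one>" unfolding loc_map_def using s(1) sc one_N by (subst quo_eq_iff) auto
    then show ?thesis using iota_times_quo[OF sc one_closed s(1)] sc by (simp add: iota_one)
  qed
  have "?y = (\<iota> s \<otimes>\<^bsub>Q\<^esub> quo \<one> s) \<otimes>\<^bsub>Q\<^esub> ?y" unfolding inv using y by simp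
  also have "\<dots> = quo \<one> s \<otimes>\<^bsub>Q\<^esub> (\<iota> s \<otimes>\<^bsub>Q\<^esub> ?y)"
    using y iota_carrier[OF sc] quo_carrier[OF one_closed s(1)] by (simp only: Q.m_ac Q.m_closed)
  also have "\<dots> = \<zero>\<^bsub>Q\<^esub>" unfolding 0 using quo_carrier[OF one_closed s(1)] by simp
  finally have "Q.eval (\<one>\<^bsub>Q\<^esub> # cs) ?x = \<zero>\<^bsub>Q\<^esub>" using cs(1) x by simp
  then show ?thesis unfolding integral_closure_def using cs(2) x by blast
qed

end

section \<open>Almost Cohen--Macaulay rings\<close>

context noetherian_cring
begin

text \<open>If \<open>p\<close> contained no nonzerodivisor, prime avoidance would put it inside an associated prime \<open>P = (0 : b)\<close> of \<open>R\<close>. A prime \<open>q \<subset> p\<close>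
  misses some \<open>z \<in> p\<close>, and \<open>z b = 0\<close> forces \<open>b \<in> q \<subseteq> P\<close>, so \<open>b\<^sup>2 = 0\<close> although \<open>b \<noteq> 0\<close>.\<close>

lemma reduced_grade_ge_1:
  assumes red: "reduced_ring R" and p: "primeideal p R" and ht: "enat 1 \<le> height R p"
  shows "enat 1 \<le> grade R p"
proof -
  note ip = primeideal_ideal[OF p] and Z = zeroideal
  have "\<not> p \<subseteq> P" if P: "P \<in> assoc_primes {\<zero>}" for P
  proof
    assume sub: "p \<subseteq> P"
    obtain b where b: "b \<in> carrier R" "b \<notin> {\<zero>}" "P = colon {\<zero>} b"
      using assoc_prime_zero_divisors[OF Z P] by blast
    obtain q where q: "primeideal q R" "q \<subset> p"
      using ht height_Suc_iff[of 0 R p] by (auto simp: Spec_def)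
    obtain z where z: "z \<in> p" "z \<notin> q" using q(2) by blast
    have "z \<otimes> b = \<zero>" using z(1) sub b(3) by (auto simp: colon_def)
    then have "z \<otimes> b \<in> q" using ideal_zero[OF primeideal_ideal[OF q(1)]] by simp
    then have "b \<in> P"
      using primeideal.I_prime[OF q(1) ideal_carr[OF ip z(1)] b(1)] z(2) q(2) sub by blast
    then have "b [^] (2::nat) = \<zero>" using b by (simp add: colon_def numeral_2_eq_2)
    then show False using red b(1,2) unfolding reduced_ring_def by blast
  qed
  then obtain y where y: "y \<in> p" "\<And>P. P \<in> assoc_primes {\<zero>} \<Longrightarrow> y \<notin> P"
    using prime_avoidance[OF finite_assoc_primes[OF Z] ip] assoc_primes_prime by metis
  have yc: "y \<in> carrier R" using ideal_carr[OF ip y(1)] .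
  have "b = \<zero>" if b: "b \<in> carrier R" "y \<otimes> b = \<zero>" for b
  proof (rule ccontr)
    assume "b \<noteq> \<zero>"
    let ?C = "colon {\<zero>} b"
    have iC: "ideal ?C R" by (rule colon_ideal[OF Z b(1)])
    have "\<one> \<notin> ?C" using \<open>b \<noteq> \<zero>\<close> b(1) by (simp add: colon_def)
    then have "?C \<noteq> carrier R" by auto
    then obtain P where P: "P \<in> assoc_primes ?C" using exists_assoc_prime[OF iC] by blast
    then obtain c where c: "c \<in> carrier R" "P = colon ?C c" by (auto simp: assoc_primes_def)
    have "P = colon {\<zero>} (c \<otimes> b)" using c b(1) by (auto simp: colon_def m_assoc)
    then have "P \<in> assoc_primes {\<zero>}" 
      using assoc_primes_prime[OF P] c(1) b(1) unfolding assoc_primes_def by blast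
    moreover have "y \<in> P" using assoc_primes_superset[OF iC P] b yc by (auto simp: colon_def)
    ultimately show False using y(2) by blast
  qed
  then have "y \<in> nonzerodivisors R" using yc by (simp add: nonzerodivisors_def)
  then show ?thesis using grade_ge_1_iff[OF p] y(1) by blast
qed

end

locale almost_CM_ring = noetherian_cring +
  assumes almost_CM: "almost_cohen_macaulay R"
begin

text \<open>The almost Cohen--Macaulay property replaces the depth of \<open>R\<^sub>p\<close> by the grade of \<open>p\<close> in \<open>R\<close>.\<close>

lemma CM_iff_grade: "primeideal p R \<Longrightarrow> p \<in> CM R \<longleftrightarrow> grade R p = height R p"
  using localization_at_prime.CM_iff[of R p] almost_CM noetherian_cring_axioms
  by (simp add: localization_at_prime_def localization_at_prime_axioms_def almost_cohen_macaulay_def Spec_def)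

lemma grade_le_1_imp_assoc_prime:
  assumes s: "s \<in> nonzerodivisors R" "s \<in> q" and q: "primeideal q R" and grade: "grade R q \<le> enat 1"
  shows "q \<in> assoc_primes (PIdl s)"
proof -
  interpret localization_at_prime R q
    by (intro localization_at_prime.intro localization_at_prime_axioms.intro noetherian_cring_axioms q)
  have "grade L (loc_ideal R q) = grade R q" 
    using almost_CM q by (simp add: almost_cohen_macaulay_def Spec_def)
  then have "\<not> enat 2 \<le> grade L (loc_ideal R q)"
    using grade enat_not_Suc_le[of 1] by (simp add: numeral_2_eq_2)
  then show ?thesis by (rule assoc_prime_if_local_grade_le_1[OF s])
qed

text \<open>Grade is monotone, so every prime \<open>q\<close> with \<open>s \<in> q \<subseteq> p\<close> has grade at most 1 and is associated to \<open>R/sR\<close>. Choosing \<open>y \<in> p\<close> outside the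
  finitely many associated primes that do not contain \<open>p\<close> makes \<open>p\<close> minimal over \<open>(s, y)\<close>.\<close>

theorem height_le_2_if_grade_1:
  assumes p: "primeideal p R" and grade: "grade R p = enat 1"
  shows "height R p \<le> enat 2"
proof (rule ccontr)
  assume "\<not> ?thesis"
  then have "enat (Suc (Suc (Suc 0))) \<le> height R p" using enat_not_Suc_le[of "Suc (Suc 0)" "height R p"] by (auto simp: numeral_2_eq_2)
  then obtain p2 p1 p0 where c: "primeideal p0 R" "primeideal p1 R" "primeideal p2 R" "p0 \<subset> p1" "p1 \<subset> p2" "p2 \<subset> p"
    unfolding height_Suc_iff by (auto simp: Spec_def)
  obtain s where s: "s \<in> p" "s \<in> nonzerodivisors R" using grade grade_ge_1_iff[OF p] by auto
  have sc: "s \<in> carrier R" using s(2) by (simp add: nonzerodivisors_def)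
  let ?F = "{q \<in> assoc_primes (PIdl s). \<not> p \<subseteq> q}"
  have "finite ?F" using finite_assoc_primes[OF cgenideal_ideal[OF sc]] by simp
  then have "\<exists>y\<in>p. \<forall>q\<in>?F. y \<notin> q"
    by (rule prime_avoidance[OF _ primeideal_ideal[OF p]]) (auto simp: assoc_primes_prime)
  then obtain y where y: "y \<in> p" "\<And>q. q \<in> assoc_primes (PIdl s) \<Longrightarrow> y \<in> q \<Longrightarrow> p \<subseteq> q" by blast
  show False
  proof (rule two_generator_height[OF c(1-3) p c(4-6) s(1) y(1)])
    fix q assume q: "primeideal q R" "s \<in> q" "y \<in> q" "q \<subseteq> p"
    have "grade R q \<le> enat 1" using grade_mono[OF q(4)] grade by simp
    then have "q \<in> assoc_primes (PIdl s)" by (rule grade_le_1_imp_assoc_prime[OF s(2) q(2,1)])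
    then show "q = p" using y(2) q(3,4) by blast
  qed
qed

end

context almost_CM_ring
begin

lemma Ass_ht_ge_2_subset:
  "ht_ge R (Ass R (normalization_mod_base R)) 2 \<subseteq> ht_eq R (Spec R) 2 - CM R"
proof
  fix p assume "p \<in> ht_ge R (Ass R (normalization_mod_base R)) 2"
  then have ht: "enat 2 \<le> height R p" and "p \<in> Ass R (normalization_mod_base R)" by (auto simp: ht_ge_def)
  then obtain a s where p: "primeideal p R" and a: "a \<in> carrier R" "s \<in> nonzerodivisors R" "p = colon (PIdl s) a"
    unfolding Ass_normalization_mod_base_iff by blast
  then have "p \<in> assoc_primes (PIdl s)" by (auto simp: assoc_primes_def)
  then have grade: "grade R p = enat 1" by (rule grade_assoc_prime_principal[OF a(2)])
  then have "height R p = enat 2" using height_le_2_if_grade_1[OF p] ht by (intro antisym)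
  then show "p \<in> ht_eq R (Spec R) 2 - CM R"
    using p grade CM_iff_grade[OF p] by (simp add: ht_eq_def Spec_def)
qed

text \<open>The prime \<open>p\<close> has grade 1, hence \<open>p = (sR : a)\<close>. The fraction \<open>a/s\<close> is integral once it is known to map \<open>p\<close> into itself. If \<open>c \<in> p\<close> had
  \<open>c a = d s\<close> with \<open>d \<notin> p\<close>, then \<open>d e\<close> would be a multiple of \<open>c\<close> for each \<open>e \<in> p\<close>, so \<open>p\<close> would be minimal over \<open>c\<close>,
  contradicting height 2.\<close>

lemma reduced_ht_eq_2_subset:
  assumes red: "reduced_ring R"
  shows "ht_eq R (Spec R) 2 - CM R \<subseteq> ht_ge R (Ass R (normalization_mod_base R)) 2"
proof
  fix p assume "p \<in> ht_eq R (Spec R) 2 - CM R"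
  then have p: "primeideal p R" and ht: "height R p = enat 2" and nCM: "p \<notin> CM R"
    by (auto simp: ht_eq_def Spec_def)
  note ip = primeideal_ideal[OF p]
  have "enat 1 \<le> grade R p" by (rule reduced_grade_ge_1[OF red p]) (simp add: ht)
  moreover have "grade R p \<le> enat 2" "grade R p \<noteq> enat 2"
    using grade_le_height[OF p] CM_iff_grade[OF p] nCM ht by auto
  ultimately have grade: "grade R p = enat 1" by (cases "grade R p") auto
  then obtain s where s: "s \<in> p" "s \<in> nonzerodivisors R" using grade_ge_1_iff[OF p] by auto
  have sc: "s \<in> carrier R" using s(2) by (simp add: nonzerodivisors_def)
  have "p \<in> assoc_primes (PIdl s)" using grade by (intro grade_le_1_imp_assoc_prime[OF s(2,1) p]) simp
  then obtain a where a: "a \<in> carrier R" "p = colon (PIdl s) a" by (auto simp: assoc_primes_def)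
  have "enat (Suc (Suc 0)) \<le> height R p" using ht by (simp add: numeral_2_eq_2)
  then obtain q1 q0 where q: "primeideal q0 R" "primeideal q1 R" "q0 \<subset> q1" "q1 \<subset> p"
    unfolding height_Suc_iff by (auto simp: Spec_def)
  have "\<exists>d\<in>p. c \<otimes> a = d \<otimes> s" if c: "c \<in> p" for c
  proof -
    have cc: "c \<in> carrier R" using ideal_carr[OF ip c] .
    obtain d where d: "d \<in> carrier R" "c \<otimes> a = d \<otimes> s" using c a(2) by (auto simp: colon_def PIdl_iff)
    have "d \<in> p"
    proof (rule ccontr)
      assume dp: "d \<notin> p"
      show False
      proof (rule principal_ideal_theorem[OF q(1,2) p q(3,4) c])
        fix P assume P: "primeideal P R" "q0 \<subseteq> P" "c \<in> P" "P \<subseteq> p"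
        have "e \<in> P" if e: "e \<in> p" for e
        proof -
          have ec: "e \<in> carrier R" using ideal_carr[OF ip e] .
          obtain f where f: "f \<in> carrier R" "e \<otimes> a = f \<otimes> s" using e a(2) by (auto simp: colon_def PIdl_iff)
          have "s \<otimes> (e \<otimes> d \<ominus> f \<otimes> c) = e \<otimes> (d \<otimes> s) \<ominus> c \<otimes> (f \<otimes> s)"
            using sc ec d(1) f(1) cc by algebra
          also have "\<dots> = \<zero>"
            unfolding d(2)[symmetric] f(2)[symmetric] using ec cc a(1) by algebra
          finally have "e \<otimes> d \<ominus> f \<otimes> c = \<zero>" using s(2) ec d(1) f(1) cc by (auto simp: nonzerodivisors_def)
          then have "e \<otimes> d = f \<otimes> c" using ec d(1) f(1) cc by simp
          then have "e \<otimes> d \<in> P" using ideal_mult[OF primeideal_ideal[OF P(1)] P(3) f(1)] by simp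
          then show ?thesis using primeideal.I_prime[OF P(1) ec d(1)] dp P(4) by blast
        qed
        then show "P = p" using P(4) by blast
      qed
    qed
    then show ?thesis using d(2) by blast
  qed
  then have "fraction R (nonzerodivisors R) a s \<in> integral_closure (total_quot R) (base_image R)"
    by (rule integral_if_stabilizes_ideal[OF ip s(2,1) a(1)])
  then have "p \<in> Ass R (normalization_mod_base R)"
    unfolding Ass_normalization_mod_base_iff using p a s(2) by blast
  then show "p \<in> ht_ge R (Ass R (normalization_mod_base R)) 2" using ht by (simp add: ht_ge_def)
qed

lemma reduced_CM_if_height_le_1:
  assumes red: "reduced_ring R" and p: "primeideal p R" and ht: "height R p \<le> enat 1"
  shows "p \<in> CM R"
proof -
  have le: "grade R p \<le> height R p" by (rule grade_le_height[OF p])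
  have "height R p \<le> grade R p"
  proof (cases "enat 1 \<le> height R p")
    case True
    then show ?thesis using reduced_grade_ge_1[OF red p] ht by (meson order_trans)
  next
    case False
    then have "height R p \<le> enat 0" using enat_not_Suc_le[of 0] by simp
    then show ?thesis by (simp add: zero_enat_def[symmetric])
  qed
  then show ?thesis using le CM_iff_grade[OF p] by simp
qed

text \<open>The complement of the Cohen--Macaulay locus is \<open>V(E)\<close>, and it contains no primes of height at most 1. Its members of height 2 are
  therefore minimal over \<open>E\<close> and so associated to the ideal generated by \<open>E\<close>.\<close>

lemma reduced_finite_ht_eq_2:
  assumes red: "reduced_ring R" and op: "openin (zariski R) (CM R)"
  shows "finite (ht_eq R (Spec R) 2 - CM R)"
proof -
  obtain E where E: "E \<subseteq> carrier R" "CM R = {p \<in> Spec R. \<not> E \<subseteq> p}"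
    using op openin_zariski[OF is_cring] by auto
  have J: "ideal (Idl E) R" by (rule genideal_ideal[OF E(1)])
  have "p \<in> assoc_primes (Idl E)" if "p \<in> ht_eq R (Spec R) 2 - CM R" for p
  proof -
    have p: "primeideal p R" and ht: "height R p = enat 2" and Ep: "E \<subseteq> p"
      using that E(2) by (auto simp: ht_eq_def Spec_def)
    obtain P where P: "P \<in> assoc_primes (Idl E)" "P \<subseteq> p"
      using assoc_prime_below[OF J p genideal_minimal[OF primeideal_ideal[OF p] Ep]] by blast
    have pP: "primeideal P R" using P(1) by (rule assoc_primes_prime)
    have "E \<subseteq> P" using assoc_primes_superset[OF J P(1)] genideal_self[OF E(1)] by blast
    then have "P \<notin> CM R" using E(2) by blast
    then have "\<not> height R P \<le> enat 1" using reduced_CM_if_height_le_1[OF red pP] by blast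
    then have "enat (Suc 1) \<le> height R P" using enat_not_Suc_le by blast
    then have "\<not> P \<subset> p" using height_mono_strict[of P R p "Suc 1"] pP ht by (auto simp: Spec_def)
    then show ?thesis using P by blast
  qed
  then show ?thesis using finite_assoc_primes[OF J] by (meson finite_subset subsetI)
qed

end

theorem proposition2p13:
  fixes R :: "('a, 'm) ring_scheme" and d :: enat
  assumes "cring R" and "noetherian_ring R"
    and "krull_dim R = d" and "d \<ge> 2"
    and "almost_cohen_macaulay R"
  shows "ht_ge R (Ass R (normalization_mod_base R)) 2 \<subseteq> ht_eq R (Spec R) 2 - CM R \<and>
    (reduced_ring R \<longrightarrow>
       ht_ge R (Ass R (normalization_mod_base R)) 2 = ht_eq R (Spec R) 2 - CM R \<and>
       (openin (zariski R) (CM R) \<longrightarrow> finite (ht_ge R (Ass R (normalization_mod_base R)) 2)))"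
proof -
  interpret almost_CM_ring R
    using assms by (intro almost_CM_ring.intro noetherian_cring.intro almost_CM_ring_axioms.intro)
  show ?thesis
    using Ass_ht_ge_2_subset reduced_ht_eq_2_subset reduced_finite_ht_eq_2
    by (metis subset_antisym)
qed

end
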